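(* Let $d$ be a positive real number and let $c \in (0,1)$. Let $Q$ be a transition matrix on $\mathbb{Z}_{\geq 0}$ that is $d$-driftable, extremely aperiodic, and $\psi$-irreducible for some measure $\psi$ on $\mathbb{Z}_{\geq 0}$ with $\psi(\mathbb{Z}_{\geq 0})>0$. Then there exist a unique probability measure $\pi$ on $\mathbb{Z}_{\geq 0}$ with $\pi Q = \pi$, and constants $C_{Q,c,d} \in \mathbb{R}_{>0}$ and $\rho_{Q,c,d} \in (0,1)$, depending only on $Q$, $c$ and $d$, such that the following holds. If $\{X_i\}_{i \in \mathbb{Z}_{\geq 0}}$ is a sequence of random variables on a probability space, with $X_i$ taking values in $\{0, \dots, i\}$, that is $c$-transitioning with $Q$, then $$\|\mu_{X_r} - \pi\|_1 \leq C_{Q,c,d} \cdot \rho_{Q,c,d}^r$$ for each $r \in \mathbb{Z}_{\geq 0}$.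
   Context: A transition matrix on a countable set $\Omega$ (here $\Omega = \mathbb{Z}_{\geq 0}$) is a function $P : \Omega \times \Omega \to \mathbb{R}_{\geq 0}$ such that $\{x : P(x,y)>0\}$ is finite for all $y \in \Omega$, $\{y : P(x,y)>0\}$ is finite for all $x \in \Omega$, and $\sum_{y \in \Omega} P(x,y) = 1$ for all $x \in \Omega$. For a probability measure $\mu$ on $\Omega$ (viewed as a function $\Omega\to\mathbb{R}_{\geq 0}$), $(\mu P)(y) = \sum_{x} P(x,y)\mu(x)$; for a function $V$ on $\Omega$, $(PV)(x) = \sum_y P(x,y) V(y)$. For $A \subseteq \Omega$, $P^n(x,A)$ is the probability that the Markov chain with transition matrix $P$ started at $x$ is in $A$ after $n$ steps. For a measure $\psi : \Omega \to \mathbb{R}_{\geq 0}$ (every subset of $\Omega$ being measurable) with $\psi(\Omega)>0$, $P$ is $\psi$-irreducible if for every $x \in \Omega$ and every $A \subseteq \Omega$ with $\psi(A) > 0$ there is a positive integer $n$ with $P^n(x,A) > 0$. $P$ is extremely aperiodic if $P(x,x)>0$ for all $x \in \Omega$. A function $V : \Omega \to \mathbb{R}_{\geq 1}$ is a drift function for $P$ if there is some $\lambda < 1$ with $PV(x) \leq \lambda V(x)$ for all but finitely many $x \in \Omega$, and $\{x \in \Omega : V(x) \leq r\}$ is finite for every real number $r$. For a positive real number $d$, a transition matrix $Q$ on $\mathbb{Z}_{\geq 0}$ is $d$-driftable if $x \mapsto d^x$ is a drift function for $Q$. Let $(A,\mathbb{P})$ be a probability space and $c \in (0,1)$. A sequence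 of random variables $X_i : A \to \{0,\dots,i\}$, $i \in \mathbb{Z}_{\geq 0}$, is $c$-transitioning with $Q$ if there exists a sequence of random variables $Z_i : A \to \{0,1\}$, $i \in \mathbb{Z}_{\ge 0}$, such that $\mathbb{P}(Z_i = 1) \leq c^i$ and $$\mathbb{P}(X_{i+1} = j \mid X_i = s, Z_i = 0) = Q(s,j)$$ for each $s \in \{0,\dots,i\}$ and $j \in \{0,\dots,i+1\}$ (the condition being imposed when the conditioning event has positive probability). For a random variable $X$ with values in $\mathbb{Z}_{\geq 0}$, $\mu_X(j) := \mathbb{P}(X=j)$. For $f : \mathbb{Z}_{\geq 0} \to \mathbb{R}$, $\|f\|_1 = \sum_{j\ge 0} |f(j)|$. *)

theory Defs
  imports "HOL-Probability.Probability"
begin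

section \<open>Transition matrices on the nonnegative integers\<close>

definition transition_matrix :: "(nat \<Rightarrow> nat \<Rightarrow> real) \<Rightarrow> bool" where
  "transition_matrix P \<longleftrightarrow>
     (\<forall>x y. 0 \<le> P x y) \<and>
     (\<forall>y. finite {x. P x y > 0}) \<and>
     (\<forall>x. finite {y. P x y > 0}) \<and>
     (\<forall>x. (\<Sum>y. P x y) = 1)"

text \<open>For a transition matrix, only finitely many terms of each of the next two series are nonzero.\<close>

definition left_act :: "(nat \<Rightarrow> real) \<Rightarrow> (nat \<Rightarrow> nat \<Rightarrow> real) \<Rightarrow> nat \<Rightarrow> real" where
  "left_act \<mu> P y = (\<Sum>x. P x y * \<mu> x)"

definition right_act :: "(nat \<Rightarrow> nat \<Rightarrow> real) \<Rightarrow> (nat \<Rightarrow> real) \<Rightarrow> nat \<Rightarrow> real" where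
  "right_act P V x = (\<Sum>y. P x y * V y)"

text \<open>The probability that the chain started at \<open>x\<close> is in \<open>A\<close> after \<open>n\<close> steps, by
  conditioning on the first step.\<close>

primrec nstep_prob :: "(nat \<Rightarrow> nat \<Rightarrow> real) \<Rightarrow> nat \<Rightarrow> nat \<Rightarrow> nat set \<Rightarrow> real" where
  "nstep_prob P 0 x A = indicator A x"
| "nstep_prob P (Suc n) x A = (\<Sum>z. P x z * nstep_prob P n z A)"

text \<open>A function \<open>\<psi>\<close> with nonnegative real values is identified with the measure
  \<open>A \<mapsto> \<Sum>x\<in>A. \<psi> x\<close> on all subsets; the total mass may be infinite.\<close>

definition weight_measure :: "(nat \<Rightarrow> real) \<Rightarrow> nat measure" where
  "weight_measure \<psi> = point_measure UNIV (\<lambda>x. ennreal (\<psi> x))"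

definition psi_irreducible :: "(nat \<Rightarrow> real) \<Rightarrow> (nat \<Rightarrow> nat \<Rightarrow> real) \<Rightarrow> bool" where
  "psi_irreducible \<psi> P \<longleftrightarrow>
     (\<forall>x A. emeasure (weight_measure \<psi>) A > 0 \<longrightarrow> (\<exists>n>0. nstep_prob P n x A > 0))"

definition extremely_aperiodic :: "(nat \<Rightarrow> nat \<Rightarrow> real) \<Rightarrow> bool" where
  "extremely_aperiodic P \<longleftrightarrow> (\<forall>x. P x x > 0)"

definition drift_function :: "(nat \<Rightarrow> nat \<Rightarrow> real) \<Rightarrow> (nat \<Rightarrow> real) \<Rightarrow> bool" where
  "drift_function P V \<longleftrightarrow>
     (\<forall>x. 1 \<le> V x) \<and>
     (\<exists>l<1. finite {x. \<not> right_act P V x \<le> l * V x}) \<and>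
     (\<forall>r::real. finite {x. V x \<le> r})"

definition driftable :: "real \<Rightarrow> (nat \<Rightarrow> nat \<Rightarrow> real) \<Rightarrow> bool" where
  "driftable d Q \<longleftrightarrow> drift_function Q (\<lambda>x. d ^ x)"

definition stationary :: "nat pmf \<Rightarrow> (nat \<Rightarrow> nat \<Rightarrow> real) \<Rightarrow> bool" where
  "stationary \<pi> Q \<longleftrightarrow> left_act (pmf \<pi>) Q = pmf \<pi>"


section \<open>Processes that are approximately Markov\<close>

text \<open>Measurability into \<open>count_space S\<close> includes that the values lie in \<open>S\<close>.\<close>

definition c_transitioning ::
  "real \<Rightarrow> (nat \<Rightarrow> nat \<Rightarrow> real) \<Rightarrow> 'a measure \<Rightarrow> (nat \<Rightarrow> 'a \<Rightarrow> nat) \<Rightarrow> bool" where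
  "c_transitioning c Q M X \<longleftrightarrow>
     (\<forall>i. X i \<in> measurable M (count_space {0..i})) \<and>
     (\<exists>Z :: nat \<Rightarrow> 'a \<Rightarrow> nat.
        (\<forall>i. Z i \<in> measurable M (count_space {0, 1})) \<and>
        (\<forall>i. \<P>(\<omega> in M. Z i \<omega> = 1) \<le> c ^ i) \<and>
        (\<forall>i. \<forall>s\<in>{0..i}. \<forall>j\<in>{0..Suc i}.
           \<P>(\<omega> in M. X i \<omega> = s \<and> Z i \<omega> = 0) > 0 \<longrightarrow>
           \<P>(\<omega> in M. X (Suc i) \<omega> = j \<bar> X i \<omega> = s \<and> Z i \<omega> = 0) = Q s j))"

definition prob_mass :: "'a measure \<Rightarrow> ('a \<Rightarrow> nat) \<Rightarrow> nat \<Rightarrow> real" where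
  "prob_mass M Y j = \<P>(\<omega> in M. Y \<omega> = j)"

definition l1_norm :: "(nat \<Rightarrow> real) \<Rightarrow> real" where
  "l1_norm f = (\<Sum>j. \<bar>f j\<bar>)"


section \<open>The constants of the convergence bound\<close>

text \<open>
  In HOL an existential quantifier inside a formula cannot be followed by a quantifier over all
  sample space types, so a theorem of the form ``there are \<open>C\<close> and \<open>\<rho>\<close> such that for
  every \<open>M :: 'a measure\<close>'' would allow the constants to depend on the type \<open>'a\<close>.
  They are therefore named as functions of \<open>Q\<close> and \<open>c\<close> alone. They are chosen to work for
  all processes on the path space of pairs \<open>(X i, Z i)\<close>, where every process can be realized;
  that they work for a sample space of arbitrary type is left to be proved.
\<close>

definition convergence_constants :: "(nat \<Rightarrow> nat \<Rightarrow> real) \<Rightarrow> real \<Rightarrow> real \<times> real" where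
  "convergence_constants Q c =
     (SOME (C, \<rho>). 0 < C \<and> 0 < \<rho> \<and> \<rho> < 1 \<and>
        (\<forall>\<pi> (M :: (nat \<Rightarrow> nat \<times> nat) measure) X.
           stationary \<pi> Q \<longrightarrow> prob_space M \<longrightarrow> c_transitioning c Q M X \<longrightarrow>
           (\<forall>r. l1_norm (\<lambda>j. prob_mass M (X r) j - pmf \<pi> j) \<le> C * \<rho> ^ r)))"

definition conv_C :: "(nat \<Rightarrow> nat \<Rightarrow> real) \<Rightarrow> real \<Rightarrow> real" where
  "conv_C Q c = fst (convergence_constants Q c)"

definition conv_rho :: "(nat \<Rightarrow> nat \<Rightarrow> real) \<Rightarrow> real \<Rightarrow> real" where
  "conv_rho Q c = snd (convergence_constants Q c)"

end

theory Submission
  imports Defs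
begin

text \<open>
  Everything is done on the dual side, with \<open>T f = Q f\<close> acting on bounded functions. Following
  Hairer and Mattingly, drift and minorization make some power of \<open>T\<close> contract the oscillation
  of \<open>f\<close> measured against the weight \<open>2 + \<beta> (V x + V y)\<close> for \<open>x \<noteq> y\<close>; the
  contraction is seen by running two independent copies of the chain. The minorization holds at a
  single atom \<open>a\<close> of \<open>\<psi>\<close>, since irreducibility and the positive diagonal give a time at
  which \<open>a\<close> is reached from every point of a finite set. Hence \<open>T ^^ n\<close> converges
  geometrically to a functional, which is integration against \<open>\<pi>\<close>.

  One step of a \<open>c\<close>-transitioning process satisfies
  \<open>\<bar>E f (X (i + 1)) - E (T f) (X i)\<bar> \<le> 2 c ^ i\<close> when \<open>\<bar>f\<bar> \<le> 1\<close>. Replacing the process after time \<open>m\<close> by the chain costs \<open>O (c ^ m)\<close>, and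
  the chain started at \<open>X m \<le> m\<close> is within \<open>O (\<rho> ^ (r - m) d ^ m)\<close> of \<open>\<pi>\<close> at time
  \<open>r\<close>; one takes \<open>m\<close> to be a small fraction of \<open>r\<close>.
\<close>

section \<open>Sequences and elementary estimates\<close>

text \<open>Here \<open>s\<close> stands for \<open>V x + V y\<close>, and the two bounds are the
  two regimes of the contraction. For all \<open>s >= 0\<close> the gain
  \<open>2 * \<alpha>\<^sup>2\<close> from coupling pays for the drift constant, because
  \<open>\<beta>\<close> is small; for \<open>s >= R\<close> the drift alone pays.\<close>

lemma contraction_weight_ineq:
  fixes \<alpha> g K R :: real
  assumes "0 < \<alpha>" "\<alpha> \<le> 1" "0 \<le> g" "g < 1" "0 \<le> K" "2 * K < R * (1 - g)"
  obtains \<beta> \<theta> where "0 < \<beta>" "0 < \<theta>" "\<theta> < 1"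
    "\<And>s. 0 \<le> s \<Longrightarrow> 2 + \<beta> * (g * s + 2 * K) - 2 * \<alpha>\<^sup>2 \<le> \<theta> * (2 + \<beta> * s)"
    "\<And>s. R \<le> s \<Longrightarrow> 2 + \<beta> * (g * s + 2 * K) \<le> \<theta> * (2 + \<beta> * s)"
proof -
  define \<beta> where "\<beta> = \<alpha>\<^sup>2 / (2 * K + 1)"
  define \<delta> where "\<delta> = R * (1 - g) - 2 * K"
  \<comment> \<open>The first bound in the minimum serves the constant term of the coupling case,
    the second keeps the slope \<open>1 - \<epsilon> - g\<close> in \<open>s\<close> nonnegative,
    the third settles the drift case at its endpoint \<open>s = R\<close>.\<close>
  define \<epsilon> where "\<epsilon> = Min {\<alpha>\<^sup>2 / 2, (1 - g) / 2, \<beta> * \<delta> / (2 + \<beta> * R)}"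
  have R: "0 < R"
    using assms by (smt (verit) mult_nonneg_nonneg mult_nonpos_nonneg)
  have \<beta>: "0 < \<beta>" using assms by (simp add: \<beta>_def)
  have \<delta>: "0 < \<delta>" using assms by (simp add: \<delta>_def)
  have a2: "\<alpha>\<^sup>2 \<le> 1" "0 < \<alpha>\<^sup>2" using assms by (simp_all add: power_le_one)
  have \<beta>K: "\<beta> * (2 * K) \<le> \<alpha>\<^sup>2"
    using assms by (simp add: \<beta>_def field_simps)
  have pos: "0 < 2 + \<beta> * R" using \<beta> R by (simp add: add_pos_pos)
  have \<epsilon>: "0 < \<epsilon>" "\<epsilon> \<le> \<alpha>\<^sup>2 / 2" "\<epsilon> \<le> (1 - g) / 2" "\<epsilon> \<le> \<beta> * \<delta> / (2 + \<beta> * R)"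
    using assms \<beta> \<delta> pos by (auto simp: \<epsilon>_def simp del: le_divide_eq_numeral1)
  have 3: "\<epsilon> * (2 + \<beta> * R) \<le> \<beta> * \<delta>" using \<epsilon>(4) pos by (simp add: field_simps)
  show thesis
  proof (rule that[of \<beta> "1 - \<epsilon>"])
    show "0 < \<beta>" by fact
    show "0 < 1 - \<epsilon>" "1 - \<epsilon> < 1" using \<epsilon> a2 by auto
    fix s :: real
    show "2 + \<beta> * (g * s + 2 * K) - 2 * \<alpha>\<^sup>2 \<le> (1 - \<epsilon>) * (2 + \<beta> * s)" if "0 \<le> s"
    proof -
      have "0 \<le> (1 - \<epsilon> - g) * (\<beta> * s)"
        using \<epsilon> assms \<beta> that by (intro mult_nonneg_nonneg) auto
      then show ?thesis using \<beta>K \<epsilon> by (simp add: algebra_simps)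
    qed
    show "2 + \<beta> * (g * s + 2 * K) \<le> (1 - \<epsilon>) * (2 + \<beta> * s)" if "R \<le> s"
    proof -
      have "0 \<le> (1 - \<epsilon> - g) * (\<beta> * (s - R))"
        using \<epsilon> assms \<beta> that by (intro mult_nonneg_nonneg) auto
      then show ?thesis using 3 by (simp add: \<delta>_def algebra_simps)
    qed
  qed
qed

text \<open>A factor \<open>\<sigma>\<close> per block of \<open>k\<close> steps is a factor
  \<open>root k \<sigma>\<close> per step; the constant \<open>1 / \<sigma>\<close> pays for the
  incomplete last block.\<close>

lemma power_div_le_geometric:
  fixes \<sigma> :: real
  assumes "0 < \<sigma>" "\<sigma> < 1" "0 < k"
  obtains C \<rho> where "0 < C" "0 < \<rho>" "\<rho> < 1" "\<And>r. \<sigma> ^ (r div k) \<le> C * \<rho> ^ r"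
proof (rule that[of "1 / \<sigma>" "root k \<sigma>"])
  show "0 < 1 / \<sigma>" "0 < root k \<sigma>" "root k \<sigma> < 1" using assms by auto
  fix r
  have "\<sigma> ^ Suc (r div k) = root k \<sigma> ^ (k * Suc (r div k))"
    unfolding power_mult using assms by simp
  also have "\<dots> \<le> root k \<sigma> ^ r"
  proof (rule power_decreasing)
    show "r \<le> k * Suc (r div k)"
      using dividend_less_times_div[OF assms(3), of r] by simp
  qed (use assms in auto)
  finally show "\<sigma> ^ (r div k) \<le> 1 / \<sigma> * root k \<sigma> ^ r"
    using assms by (simp add: field_simps)
qed

lemma geometric_increments_limit:
  fixes u :: "nat \<Rightarrow> real"
  assumes inc: "\<And>m p. \<bar>u (m + p) - u m\<bar> \<le> D * \<rho> ^ m" and \<rho>: "0 < \<rho>" "\<rho> < 1"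
  obtains l where "u \<longlonglongrightarrow> l" "\<And>m. \<bar>u m - l\<bar> \<le> D * \<rho> ^ m"
proof -
  have D: "(\<lambda>m. D * \<rho> ^ m) \<longlonglongrightarrow> 0"
    using \<rho> by (auto intro!: tendsto_eq_intros LIMSEQ_power_zero)
  have "Cauchy u"
  proof (rule CauchyI')
    fix e :: real assume "0 < e"
    then obtain M where M: "\<And>m. M \<le> m \<Longrightarrow> D * \<rho> ^ m < e"
      using order_tendstoD(2)[OF D, of e] by (auto simp: eventually_sequentially)
    have "dist (u m) (u n) < e" if "M \<le> m" "m < n" for m n
      using inc[of m "n - m"] M[of m] that by (simp add: dist_real_def abs_minus_commute)
    then show "\<exists>M. \<forall>m\<ge>M. \<forall>n>m. dist (u m) (u n) < e" by blast
  qed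
  then obtain l where l: "u \<longlonglongrightarrow> l"
    unfolding Cauchy_convergent_iff convergent_def by blast
  have "\<bar>u m - l\<bar> \<le> D * \<rho> ^ m" for m
  proof (rule LIMSEQ_le_const2)
    show "(\<lambda>p. \<bar>u m - u (p + m)\<bar>) \<longlonglongrightarrow> \<bar>u m - l\<bar>"
      by (intro tendsto_intros LIMSEQ_ignore_initial_segment l)
    show "\<exists>N. \<forall>p\<ge>N. \<bar>u m - u (p + m)\<bar> \<le> D * \<rho> ^ m"
      using inc by (metis abs_minus_commute add.commute)
  qed
  with l show thesis by (rule that)
qed

lemma pmf_of_sums_one:
  fixes L :: "nat \<Rightarrow> real"
  assumes "\<And>j. 0 \<le> L j" "L sums 1"
  obtains p where "pmf p = L"
proof (rule that[of "embed_pmf L"])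
  have "(\<integral>\<^sup>+ j. ennreal (L j) \<partial>count_space UNIV) = 1"
    using assms by (simp add: nn_integral_count_space_nat suminf_ennreal_eq[OF assms])
  then show "pmf (embed_pmf L) = L" using assms by (auto simp: fun_eq_iff pmf_embed_pmf)
qed

lemma finite_support_eq_sum:
  fixes f :: "'a \<Rightarrow> real"
  assumes "finite S" "\<And>y. y \<notin> S \<Longrightarrow> f y = 0"
  shows "f = (\<lambda>y. \<Sum>j\<in>S. f j * indicator {j} y)"
proof
  fix y
  have "(\<Sum>j\<in>S. f j * indicator {j} y) = (\<Sum>j\<in>S. if y = j then f j else 0)"
    by (rule sum.cong) (auto simp: indicator_def)
  then show "f y = (\<Sum>j\<in>S. f j * indicator {j} y)" using assms by simp
qed

section \<open>Markov operators\<close>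

text \<open>The laws are required for all functions, not only for bounded ones, so that
  \<open>T\<close> also acts on the unbounded weight \<open>V\<close>. A transition matrix qualifies
  because its rows have finite support.\<close>

locale markov_operator =
  fixes T :: "('a \<Rightarrow> real) \<Rightarrow> 'a \<Rightarrow> real"
  assumes add: "T (\<lambda>y. f y + g y) x = T f x + T g x"
    and scale: "T (\<lambda>y. c * f y) x = c * T f x"
    and one: "T (\<lambda>_. 1) x = 1"
    and nonneg: "(\<And>y. 0 \<le> f y) \<Longrightarrow> 0 \<le> T f x"
begin

lemma const: "T (\<lambda>_. c) x = c"
  using scale[of c "\<lambda>_. 1" x] by (simp add: one)

lemma minus: "T (\<lambda>y. - f y) x = - T f x"
  using scale[of "-1" f x] by simp

lemma diff: "T (\<lambda>y. f y - g y) x = T f x - T g x"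
  using add[of f "\<lambda>y. - g y" x] by (simp add: minus)

lemma mono: "(\<And>y. f y \<le> g y) \<Longrightarrow> T f x \<le> T g x"
  using nonneg[of "\<lambda>y. g y - f y" x] by (simp add: diff)

lemma sum: "finite A \<Longrightarrow> T (\<lambda>y. \<Sum>i\<in>A. f i y) x = (\<Sum>i\<in>A. T (f i) x)"
  by (induction A rule: finite_induct) (simp_all add: add const)

lemma abs_le_one: "(\<And>y. \<bar>f y\<bar> \<le> 1) \<Longrightarrow> \<bar>T f x\<bar> \<le> 1"
  using mono[of f "\<lambda>_. 1" x] mono[of "\<lambda>_. -1" f x]
  by (force simp: const abs_le_iff minus_le_iff)

lemma power: "markov_operator (T ^^ n)"
proof (induction n)
  case 0
  show ?case by unfold_locales simp_all
next
  case (Suc n)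
  interpret P: markov_operator "T ^^ n" by (rule Suc)
  have P_add: "(T ^^ n) (\<lambda>y. f y + g y) = (\<lambda>y. (T ^^ n) f y + (T ^^ n) g y)"
    and P_scale: "(T ^^ n) (\<lambda>y. c * f y) = (\<lambda>y. c * (T ^^ n) f y)"
    and P_const: "(T ^^ n) (\<lambda>_. c) = (\<lambda>_. c)" for f g c
    by (simp_all add: fun_eq_iff P.add P.scale P.const)
  show ?case
  proof unfold_locales
    show "(T ^^ Suc n) (\<lambda>y. f y + g y) x = (T ^^ Suc n) f x + (T ^^ Suc n) g x" for f g x
      using add by (simp add: P_add)
    show "(T ^^ Suc n) (\<lambda>y. c * f y) x = c * (T ^^ Suc n) f x" for c f x
      using scale by (simp add: P_scale)
    show "(T ^^ Suc n) (\<lambda>_. 1) x = 1" for x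
      using const by (simp add: P_const)
    show "0 \<le> (T ^^ Suc n) f x" if "\<And>y. 0 \<le> f y" for f x
      using that by (simp add: P.nonneg nonneg)
  qed
qed

lemma power_abs_le_one: "(\<And>y. \<bar>f y\<bar> \<le> 1) \<Longrightarrow> \<bar>(T ^^ n) f x\<bar> \<le> 1"
  by (rule markov_operator.abs_le_one[OF power])

section \<open>Drift, coupling and contraction of the weighted oscillation\<close>

lemma power_drift:
  assumes drift: "\<And>x. T V x \<le> l * V x + b" and l: "0 \<le> l" "l < 1" and b: "0 \<le> b"
  shows "(T ^^ n) V x \<le> l ^ n * V x + b / (1 - l)"
proof (induction n arbitrary: x)
  case 0
  then show ?case using l b by simp
next
  case (Suc n)
  interpret P: markov_operator "T ^^ n" by (rule power)
  have "(T ^^ Suc n) V x = (T ^^ n) (T V) x" by (simp add: funpow_swap1)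
  also have "\<dots> \<le> (T ^^ n) (\<lambda>y. l * V y + b) x"
    by (rule P.mono) (rule drift)
  also have "\<dots> = l * (T ^^ n) V x + b"
    by (simp add: P.add P.scale P.const)
  also have "\<dots> \<le> l * (l ^ n * V x + b / (1 - l)) + b"
    using mult_left_mono[OF Suc l(1)] by simp
  \<comment> \<open>The value \<open>b / (1 - l)\<close> is the fixed point of
    \<open>t \<mapsto> l * t + b\<close>, so the same additive constant serves for every
    \<open>n\<close>.\<close>
  also have "\<dots> = l ^ Suc n * V x + b / (1 - l)"
    using l by (simp add: field_simps)
  finally show ?case .
qed


text \<open>The left side is the mean of \<open>f u - f v\<close> for independent \<open>u\<close>
  and \<open>v\<close>, one step after \<open>x\<close> and \<open>y\<close>. With probability
  \<open>T (indicator {a}) x * T (indicator {a}) y\<close> both copies are at \<open>a\<close>,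
  where \<open>f u - f v\<close> vanishes and the constant 2 of the weight is saved.\<close>

lemma coupling_bound:
  assumes "0 \<le> L" and phi: "\<And>x y. f x - f y \<le> L * (if x = y then 0 else 2 + \<beta> * (V x + V y))"
    and V: "\<And>x. 0 \<le> V x" and "0 \<le> \<beta>"
  shows "T f x - T f y
    \<le> L * (2 + \<beta> * (T V x + T V y) - 2 * (T (indicator {a}) x * T (indicator {a}) y))"
proof -
  let ?e = "indicator {a} :: 'a \<Rightarrow> real"
  \<comment> \<open>The subtracted product is nonzero only for \<open>u = v = a\<close>; there it
    cancels the constant 2 exactly and leaves a nonnegative bound.\<close>
  have 1: "f u - f v \<le> L * (2 + \<beta> * (V u + V v) - 2 * (?e u * ?e v))" for u v
  proof (cases "u = v")
    case True
    have "0 \<le> L * (2 + \<beta> * (V u + V v) - 2 * (?e u * ?e v))"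
      using assms by (intro mult_nonneg_nonneg) (auto simp: indicator_def)
    then show ?thesis using True by simp
  next
    case False
    then have e: "?e u * ?e v = 0" by (auto simp: indicator_def)
    show ?thesis unfolding e using phi[of u v] False by simp
  qed
  \<comment> \<open>The product of the two transition laws is realized by applying \<open>T\<close>
    in \<open>v\<close> with \<open>u\<close> fixed, and then in \<open>u\<close>.\<close>
  have 2: "f u - T f y \<le> L * (2 + \<beta> * (V u + T V y) - 2 * (?e u * T ?e y))" for u
  proof -
    have "T (\<lambda>v. f u - f v) y \<le> T (\<lambda>v. L * (2 + \<beta> * (V u + V v) - 2 * (?e u * ?e v))) y"
      by (rule mono) (rule 1)
    then show ?thesis by (simp add: add diff scale const)
  qed
  have "T (\<lambda>u. f u - T f y) x
      \<le> T (\<lambda>u. L * (2 + \<beta> * (V u + T V y) - 2 * (T ?e y * ?e u))) x"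
    by (rule mono) (use 2 in \<open>simp add: mult.commute\<close>)
  then show ?thesis by (simp only: add diff scale const mult.commute[of "T ?e y" "T ?e x"])
qed

text \<open>If both points lie in the sublevel set \<open>V \<le> R\<close>, the two copies meet at
  \<open>a\<close> with probability at least \<open>\<alpha>\<^sup>2\<close>; otherwise
  \<open>V x + V y \<ge> R\<close> and the drift shrinks the weight.\<close>

lemma contraction:
  assumes V: "\<And>x. 1 \<le> V x" and drift: "\<And>x. T V x \<le> g * V x + K"
    and g: "0 \<le> g" "g < 1" and K: "0 \<le> K" and R: "2 * K < R * (1 - g)"
    and \<alpha>: "0 < \<alpha>" "\<alpha> \<le> 1" and minor: "\<And>x. V x \<le> R \<Longrightarrow> \<alpha> \<le> T (indicator {a}) x"
  obtains \<beta> \<theta> where "0 < \<beta>" "0 < \<theta>" "\<theta> < 1"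
    "\<And>f L x y. 0 \<le> L \<Longrightarrow> (\<And>x y. f x - f y \<le> L * (if x = y then 0 else 2 + \<beta> * (V x + V y))) \<Longrightarrow>
      T f x - T f y \<le> \<theta> * L * (if x = y then 0 else 2 + \<beta> * (V x + V y))"
proof -
  obtain \<beta> \<theta> where bt: "0 < \<beta>" "0 < \<theta>" "\<theta> < 1"
    and near: "\<And>s. 0 \<le> s \<Longrightarrow> 2 + \<beta> * (g * s + 2 * K) - 2 * \<alpha>\<^sup>2 \<le> \<theta> * (2 + \<beta> * s)"
    and far: "\<And>s. R \<le> s \<Longrightarrow> 2 + \<beta> * (g * s + 2 * K) \<le> \<theta> * (2 + \<beta> * s)"
    using contraction_weight_ineq[OF \<alpha> g K R] by metis
  let ?e = "indicator {a} :: 'a \<Rightarrow> real"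
  have V0: "0 \<le> V x" for x using V[of x] by simp
  have main: "2 + \<beta> * (T V x + T V y) - 2 * (T ?e x * T ?e y)
      \<le> \<theta> * (2 + \<beta> * (V x + V y))" for x y
  proof -
    have "\<beta> * (T V x + T V y) \<le> \<beta> * (g * (V x + V y) + 2 * K)"
      using drift[of x] drift[of y] bt by (intro mult_left_mono) (auto simp: algebra_simps)
    moreover have e0: "0 \<le> T ?e z" for z by (rule nonneg) simp
    have "2 + \<beta> * (g * (V x + V y) + 2 * K) - 2 * (T ?e x * T ?e y) \<le> \<theta> * (2 + \<beta> * (V x + V y))"
    proof (cases "V x \<le> R \<and> V y \<le> R")
      case True
      then have "\<alpha>\<^sup>2 \<le> T ?e x * T ?e y"
        unfolding power2_eq_square using minor \<alpha> e0 by (intro mult_mono) auto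
      then show ?thesis using near[of "V x + V y"] V0[of x] V0[of y] by auto
    next
      case False
      then have "R \<le> V x + V y" using V0[of x] V0[of y] by auto
      moreover have "0 \<le> T ?e x * T ?e y" using e0 by simp
      ultimately show ?thesis using far[of "V x + V y"] by linarith
    qed
    ultimately show ?thesis by linarith
  qed
  show thesis
  proof (rule that[OF bt])
    fix f L x y
    assume L: "0 \<le> L" and f: "\<And>x y. f x - f y \<le> L * (if x = y then 0 else 2 + \<beta> * (V x + V y))"
    have "T f x - T f y \<le> L * (\<theta> * (2 + \<beta> * (V x + V y)))"
      using coupling_bound[OF L f V0, of x y a] mult_left_mono[OF main[of x y] L] bt by linarith
    then show "T f x - T f y \<le> \<theta> * L * (if x = y then 0 else 2 + \<beta> * (V x + V y))"
      by (simp add: algebra_simps)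
  qed
qed


text \<open>The power of \<open>T\<close> for which the minorization holds contracts the weighted
  oscillation; iterating it and interpolating between its multiples gives a rate for all
  times.\<close>

lemma geometric_contraction:
  assumes V: "\<And>x. 1 \<le> V x" and drift: "\<And>x. T V x \<le> l * V x + b"
    and l: "0 \<le> l" "l < 1" and b: "0 \<le> b"
    and minor: "\<And>R. \<exists>n>0. \<exists>\<alpha>>0. \<forall>x. V x \<le> R \<longrightarrow> \<alpha> \<le> (T ^^ n) (indicator {a}) x"
  obtains C \<rho> where "0 < C" "0 < \<rho>" "\<rho> < 1"
    "\<And>f m x y. (\<And>z. \<bar>f z\<bar> \<le> 1) \<Longrightarrow> (T ^^ m) f x - (T ^^ m) f y \<le> C * \<rho> ^ m * (V x + V y)"
proof -
  \<comment> \<open>\<open>K\<close> is a drift constant common to all powers of \<open>T\<close>,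
    so \<open>R\<close> can be fixed before the number of steps \<open>n\<close> that its sublevel
    set requires.\<close>
  define K where "K = b / (1 - l)"
  define R where "R = 2 * K / (1 - l) + 1"
  have K: "0 \<le> K" using b l by (simp add: K_def)
  have R: "2 * K < R * (1 - l)" using l by (simp add: R_def distrib_right)
  obtain n \<alpha>' where n: "0 < n" and "0 < \<alpha>'"
    and \<alpha>': "\<And>x. V x \<le> R \<Longrightarrow> \<alpha>' \<le> (T ^^ n) (indicator {a}) x" using minor[of R] by auto
  define \<alpha> where "\<alpha> = min \<alpha>' 1"
  have \<alpha>: "0 < \<alpha>" "\<alpha> \<le> 1" "\<And>x. V x \<le> R \<Longrightarrow> \<alpha> \<le> (T ^^ n) (indicator {a}) x"
    using \<open>0 < \<alpha>'\<close> \<alpha>' by (fastforce simp: \<alpha>_def)+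
  interpret P: markov_operator "T ^^ n" by (rule power)
  have Pdrift: "(T ^^ n) V x \<le> l * V x + K" for x
  proof -
    have "l ^ n \<le> l ^ 1" by (rule power_decreasing) (use n l in auto)
    then have "l ^ n * V x \<le> l * V x" using V[of x] by (intro mult_right_mono) auto
    then show ?thesis using power_drift[where V = V, OF drift l b, of n x] by (simp add: K_def)
  qed
  obtain \<beta> \<theta> where bt: "0 < \<beta>" "0 < \<theta>" "\<theta> < 1"
    and contr: "\<And>f L x y. 0 \<le> L \<Longrightarrow> (\<And>x y. f x - f y \<le> L * (if x = y then 0 else 2 + \<beta> * (V x + V y))) \<Longrightarrow>
      (T ^^ n) f x - (T ^^ n) f y \<le> \<theta> * L * (if x = y then 0 else 2 + \<beta> * (V x + V y))"
    using P.contraction[OF V Pdrift l K R \<alpha>(1,2) \<alpha>(3)] by metis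
  have iter: "((T ^^ n) ^^ k) f x - ((T ^^ n) ^^ k) f y \<le> \<theta> ^ k * (if x = y then 0 else 2 + \<beta> * (V x + V y))"
    if "\<And>z. \<bar>f z\<bar> \<le> 1" for f k x y
  proof (induction k arbitrary: x y)
    case 0
    \<comment> \<open>The constant 2 in the weight is the largest oscillation of a function bounded
      by 1, so the iteration starts with \<open>L = 1\<close>.\<close>
    have "f x - f y \<le> 2" "0 \<le> \<beta> * (V x + V y)"
      using that[of x] that[of y] V[of x] V[of y] bt by auto
    then show ?case by auto
  next
    case (Suc k)
    have "(T ^^ n) (((T ^^ n) ^^ k) f) x - (T ^^ n) (((T ^^ n) ^^ k) f) y
        \<le> \<theta> * \<theta> ^ k * (if x = y then 0 else 2 + \<beta> * (V x + V y))"
      by (rule contr) (use bt Suc in auto)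
    then show ?case by simp
  qed
  obtain C \<rho> where C: "0 < C" "0 < \<rho>" "\<rho> < 1" "\<And>r. \<theta> ^ (r div n) \<le> C * \<rho> ^ r"
    using power_div_le_geometric[OF bt(2,3) n] by metis
  show thesis
  proof (rule that[of "C * (1 + \<beta>)" \<rho>])
    fix f :: "'a \<Rightarrow> real" and m x y
    assume f: "\<And>z. \<bar>f z\<bar> \<le> 1"
    \<comment> \<open>The \<open>m mod n\<close> leftover steps act on \<open>f\<close> first and
      keep it bounded by 1, so the iterated contraction applies to the result.\<close>
    define g where "g = (T ^^ (m mod n)) f"
    have g: "\<bar>g z\<bar> \<le> 1" for z unfolding g_def by (rule power_abs_le_one[OF f])
    have eq: "(T ^^ m) f = ((T ^^ n) ^^ (m div n)) g"
    proof -
      have "(T ^^ m) f = (T ^^ (n * (m div n) + m mod n)) f" by simp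
      also have "\<dots> = ((T ^^ n) ^^ (m div n)) g"
        by (simp only: funpow_add o_apply funpow_mult g_def mult.commute)
      finally show ?thesis .
    qed
    let ?w = "if x = y then 0 else 2 + \<beta> * (V x + V y)"
    have V0: "1 \<le> V x" "1 \<le> V y" by (rule V)+
    then have "0 \<le> \<beta> * (V x + V y)" using bt by auto
    \<comment> \<open>Since \<open>V\<close> is at least 1, the constant 2 is absorbed into
      \<open>V x + V y\<close>.\<close>
    then have w: "0 \<le> ?w" "?w \<le> (1 + \<beta>) * (V x + V y)"
      using V0 by (auto simp: distrib_right)
    have "(T ^^ m) f x - (T ^^ m) f y \<le> \<theta> ^ (m div n) * ?w"
      unfolding eq by (rule iter[OF g])
    also have "\<dots> \<le> (C * \<rho> ^ m) * ((1 + \<beta>) * (V x + V y))"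
      by (rule mult_mono[OF C(4) w(2) _ w(1)]) (use C in auto)
    finally show "(T ^^ m) f x - (T ^^ m) f y \<le> C * (1 + \<beta>) * \<rho> ^ m * (V x + V y)"
      by (simp add: algebra_simps)
  qed (use C bt in auto)
qed

text \<open>Closeness between starting points becomes closeness in time:
  \<open>(T ^^ (m + p)) f x\<close> averages \<open>(T ^^ m) f y\<close> over the states
  \<open>y\<close> reached from \<open>x\<close> in \<open>p\<close> steps, and the mean of
  \<open>V y\<close> is at most a constant times \<open>V x\<close>, uniformly in \<open>p\<close>.
  So the sequence is Cauchy with a geometric rate.\<close>

lemma geometric_ergodicity:
  assumes V: "\<And>x. 1 \<le> V x" and drift: "\<And>x. T V x \<le> l * V x + b"
    and l: "0 \<le> l" "l < 1" and b: "0 \<le> b"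
    and minor: "\<And>R. \<exists>n>0. \<exists>\<alpha>>0. \<forall>x. V x \<le> R \<longrightarrow> \<alpha> \<le> (T ^^ n) (indicator {a}) x"
  obtains D \<rho> ell where "0 < D" "0 < \<rho>" "\<rho> < 1"
    "\<And>f m x. (\<And>z. \<bar>f z\<bar> \<le> 1) \<Longrightarrow> \<bar>(T ^^ m) f x - ell f\<bar> \<le> D * \<rho> ^ m * V x"
proof -
  obtain C \<rho> where C: "0 < C" "0 < \<rho>" "\<rho> < 1"
    and geo: "\<And>f m x y. (\<And>z. \<bar>f z\<bar> \<le> 1) \<Longrightarrow> (T ^^ m) f x - (T ^^ m) f y \<le> C * \<rho> ^ m * (V x + V y)"
    using geometric_contraction[where V = V, OF V drift l b minor] by metis
  define K where "K = b / (1 - l)"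
  define D where "D = C * (2 + K)"
  have K: "0 \<le> K" using b l by (simp add: K_def)
  have D: "0 < D" using C K by (simp add: D_def)
  have TV: "(T ^^ p) V x \<le> (1 + K) * V x" for p x
  proof -
    have "l ^ p * V x \<le> 1 * V x"
      using l V[of x] by (intro mult_right_mono) (auto simp: power_le_one)
    moreover have "K \<le> K * V x" using V[of x] K mult_left_mono[of 1 "V x" K] by simp
    ultimately show ?thesis
      using power_drift[where V = V, OF drift l b, of p x] by (simp add: K_def algebra_simps)
  qed
  have inc: "\<bar>(T ^^ (m + p)) f x - (T ^^ m) f x\<bar> \<le> D * V x * \<rho> ^ m"
    if f: "\<And>z. \<bar>f z\<bar> \<le> 1" for f m p x
  proof -
    interpret P: markov_operator "T ^^ p" by (rule power)
    let ?g = "(T ^^ m) f"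
    have g: "?g y - ?g z \<le> C * \<rho> ^ m * (V y + V z)" for y z by (rule geo[OF f])
    have split: "(T ^^ (m + p)) f x = (T ^^ p) ?g x"
      by (simp add: add.commute[of m p] funpow_add)
    have "(T ^^ p) ?g x \<le> (T ^^ p) (\<lambda>y. (?g x + C * \<rho> ^ m * V x) + C * \<rho> ^ m * V y) x"
      by (rule P.mono) (use g[of _ x] in \<open>simp add: algebra_simps\<close>)
    also have "\<dots> = ?g x + C * \<rho> ^ m * (V x + (T ^^ p) V x)"
      by (simp only: P.add P.scale P.const) (simp add: algebra_simps)
    finally have 1: "(T ^^ p) ?g x - ?g x \<le> C * \<rho> ^ m * (V x + (T ^^ p) V x)" by simp
    have "(T ^^ p) (\<lambda>y. (?g x - C * \<rho> ^ m * V x) - C * \<rho> ^ m * V y) x \<le> (T ^^ p) ?g x"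
      by (rule P.mono) (use g[of x] in \<open>simp add: algebra_simps\<close>)
    then have 2: "?g x - (T ^^ p) ?g x \<le> C * \<rho> ^ m * (V x + (T ^^ p) V x)"
      by (simp only: P.diff P.scale P.const) (simp add: algebra_simps)
    have "C * \<rho> ^ m * (V x + (T ^^ p) V x) \<le> C * \<rho> ^ m * ((2 + K) * V x)"
      using TV[of p x] C by (intro mult_left_mono) (auto simp: algebra_simps)
    also have "\<dots> = D * V x * \<rho> ^ m" by (simp add: D_def)
    finally show ?thesis unfolding split using 1 2 by linarith
  qed
  have "\<exists>c. \<forall>m x. \<bar>(T ^^ m) f x - c\<bar> \<le> D * \<rho> ^ m * V x" if f: "\<And>z. \<bar>f z\<bar> \<le> 1" for f
  proof -
    have "\<exists>c. (\<lambda>m. (T ^^ m) f x) \<longlonglongrightarrow> c \<and> (\<forall>m. \<bar>(T ^^ m) f x - c\<bar> \<le> D * V x * \<rho> ^ m)" for x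
      using geometric_increments_limit[OF inc[where f = f and x = x, OF f] C(2,3)] by metis
    then obtain c where lim: "\<And>x. (\<lambda>m. (T ^^ m) f x) \<longlonglongrightarrow> c x"
      and c: "\<And>x m. \<bar>(T ^^ m) f x - c x\<bar> \<le> D * V x * \<rho> ^ m" by metis
    \<comment> \<open>The contraction between two starting points forces their limits to
      agree.\<close>
    have "c x \<le> c y" for x y
    proof -
      have "(\<lambda>m. C * \<rho> ^ m * (V x + V y)) \<longlonglongrightarrow> 0"
        using C by (auto intro!: tendsto_eq_intros LIMSEQ_power_zero)
      then have "c x - c y \<le> 0"
      proof (rule LIMSEQ_le[rotated])
        show "(\<lambda>m. (T ^^ m) f x - (T ^^ m) f y) \<longlonglongrightarrow> c x - c y"
          by (intro tendsto_intros lim)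
        show "\<exists>N. \<forall>m\<ge>N. (T ^^ m) f x - (T ^^ m) f y \<le> C * \<rho> ^ m * (V x + V y)"
          using geo[where f = f, OF f] by simp
      qed
      then show ?thesis by simp
    qed
    \<comment> \<open>The point \<open>undefined\<close> is an arbitrary reference state.\<close>
    then have "c x = c undefined" for x by (meson antisym)
    then show ?thesis using c by (metis mult.assoc mult.commute)
  qed
  then obtain ell where "\<And>f m x. (\<And>z. \<bar>f z\<bar> \<le> 1) \<Longrightarrow> \<bar>(T ^^ m) f x - ell f\<bar> \<le> D * \<rho> ^ m * V x"
    by metis
  with D C(2,3) show thesis by (rule that)
qed

end

text \<open>A pointwise limit of probability laws could lose mass at infinity. The bounded mean of
  \<open>V\<close>, whose sublevel sets are finite, gives tightness and prevents this.\<close>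

lemma limit_pmf:
  fixes V :: "nat \<Rightarrow> real" and S :: "(nat \<Rightarrow> real) \<Rightarrow> nat \<Rightarrow> real"
  assumes TM: "markov_operator S"
    and V: "\<And>x. 1 \<le> V x" and fin: "\<And>r. finite {x. V x \<le> r}"
    and SV: "\<And>m. (S ^^ m) V x0 \<le> B"
    and lim: "\<And>j. (\<lambda>m. (S ^^ m) (indicator {j}) x0) \<longlonglongrightarrow> L j"
  obtains p where "pmf p = L"
proof -
  interpret S: markov_operator S by (rule TM)
  have L0: "0 \<le> L j" for j
    by (rule LIMSEQ_le_const[OF lim])
       (auto intro!: exI[of _ 0] markov_operator.nonneg[OF S.power])
  have ind: "(\<lambda>m. (S ^^ m) (indicator A) x0) \<longlonglongrightarrow> (\<Sum>j\<in>A. L j)" if A: "finite A" for A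
  proof -
    have "(indicator A :: nat \<Rightarrow> real) = (\<lambda>y. \<Sum>j\<in>A. indicator {j} y)"
      using A by (auto simp: fun_eq_iff indicator_def sum.If_cases)
    then have "(S ^^ m) (indicator A) x0 = (\<Sum>j\<in>A. (S ^^ m) (indicator {j}) x0)" for m
      using markov_operator.sum[OF S.power A, where f = "\<lambda>j. indicator {j}"] by simp
    then show ?thesis by (simp add: tendsto_sum lim)
  qed
  have le1: "(\<Sum>j\<in>A. L j) \<le> 1" if A: "finite A" for A
  proof (rule LIMSEQ_le_const2[OF ind[OF A]])
    have "(S ^^ m) (indicator A) x0 \<le> 1" for m
      using S.power_abs_le_one[where f = "indicator A" and n = m and x = x0] by (simp add: indicator_def)
    then show "\<exists>N. \<forall>m\<ge>N. (S ^^ m) (indicator A) x0 \<le> 1" by blast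
  qed
  have sm: "summable L" by (rule summableI_nonneg_bounded[where x = 1]) (simp_all add: L0 le1)
  have "suminf L \<le> 1" by (rule suminf_le_const[OF sm]) (simp add: le1)
  moreover have "1 \<le> suminf L + e" if "0 < e" for e
  proof -
    \<comment> \<open>At most the mass \<open>B / r \<le> e\<close> lies outside
      \<open>V \<le> r\<close>; the maximum with 1 keeps \<open>r\<close> positive.\<close>
    define r where "r = max 1 (B / e)"
    have r: "0 < r" "B / r \<le> e"
      using that by (auto simp: r_def field_simps max_def split: if_splits)
    let ?A = "{x. V x \<le> r}"
    have "1 - B / r \<le> (S ^^ m) (indicator ?A) x0" for m
    proof -
      interpret P: markov_operator "S ^^ m" by (rule S.power)
      \<comment> \<open>This is Markov's inequality, obtained by integrating
        \<open>1 - V y / r \<le> indicator ?A y\<close>.\<close>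
      have "(S ^^ m) (\<lambda>y. 1 - (1 / r) * V y) x0 \<le> (S ^^ m) (indicator ?A) x0"
      proof (rule P.mono)
        show "1 - (1 / r) * V y \<le> indicator ?A y" for y
          using r(1) V[of y] by (cases "V y \<le> r") (simp_all add: field_simps)
      qed
      moreover have "(S ^^ m) (\<lambda>y. 1 - (1 / r) * V y) x0 = 1 - (1 / r) * (S ^^ m) V x0"
        by (subst P.diff, subst P.scale, subst P.const) simp
      moreover have "(1 / r) * (S ^^ m) V x0 \<le> (1 / r) * B"
        using SV r by (intro mult_left_mono) auto
      ultimately show ?thesis by simp
    qed
    then have "1 - B / r \<le> (\<Sum>j\<in>?A. L j)"
      by (intro LIMSEQ_le_const[OF ind[OF fin]]) simp
    also have "\<dots> \<le> suminf L"
      by (rule sum_le_suminf[OF sm fin]) (use L0 in blast)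
    finally show ?thesis using r by simp
  qed
  then have "1 \<le> suminf L" by (rule field_le_epsilon)
  ultimately have "L sums 1" using sm by (simp add: sums_iff)
  from pmf_of_sums_one[OF L0 this] that show thesis by blast
qed

section \<open>Geometric ergodicity of transition matrices\<close>

lemma right_act_eq_sum:
  assumes "finite S" "\<And>y. y \<notin> S \<Longrightarrow> Q x y * f y = 0"
  shows "right_act Q f x = (\<Sum>y\<in>S. Q x y * f y)"
  unfolding right_act_def using assms by (rule suminf_finite)

lemma transition_matrixD:
  assumes "transition_matrix Q"
  shows "0 \<le> Q x y" "finite {x. Q x y \<noteq> 0}" "finite {y. Q x y \<noteq> 0}" "(\<Sum>y. Q x y) = 1"
proof -
  have "Q x y \<noteq> 0 \<longleftrightarrow> Q x y > 0" for x y
    using assms by (auto simp: transition_matrix_def order_less_le)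
  then show "0 \<le> Q x y" "finite {x. Q x y \<noteq> 0}" "finite {y. Q x y \<noteq> 0}" "(\<Sum>y. Q x y) = 1"
    using assms by (auto simp: transition_matrix_def)
qed

lemma transition_matrix_markov_operator:
  assumes Q: "transition_matrix Q"
  shows "markov_operator (right_act Q)"
proof -
  note Q = transition_matrixD[OF Q]
  have eq: "right_act Q f x = (\<Sum>y | Q x y \<noteq> 0. Q x y * f y)" for f x
    by (rule right_act_eq_sum) (use Q in auto)
  show ?thesis
  proof
    show "right_act Q (\<lambda>y. f y + g y) x = right_act Q f x + right_act Q g x" for f g x
      by (simp add: eq sum.distrib algebra_simps)
    show "right_act Q (\<lambda>y. c * f y) x = c * right_act Q f x" for c f x
      by (simp add: eq sum_distrib_left algebra_simps)
    show "right_act Q (\<lambda>_. 1) x = 1" for x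
      using Q(4) by (simp add: right_act_def)
    show "0 \<le> right_act Q f x" if "\<And>y. 0 \<le> f y" for f x
      using that Q(1) by (auto simp: eq intro!: sum_nonneg)
  qed
qed

lemma nstep_prob_eq: "nstep_prob Q n x A = (right_act Q ^^ n) (indicator A) x"
proof (induction n arbitrary: x)
  case (Suc n)
  then show ?case by (simp add: right_act_def)
qed simp

section \<open>A state to be hit, and the drift and minorization conditions\<close>

lemma weight_measure_atom:
  assumes "emeasure (weight_measure \<psi>) UNIV > 0"
  obtains a where "emeasure (weight_measure \<psi>) {a} > 0"
proof (rule ccontr)
  assume "\<not> thesis"
  then have "emeasure (weight_measure \<psi>) {a} = 0" for a
    using that by (auto simp: zero_less_iff_neq_zero)
  then have "emeasure (weight_measure \<psi>) (\<Union>a. {a}) = 0"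
    by (intro emeasure_UN_eq_0) (auto simp: weight_measure_def sets_point_measure)
  with assms show False by simp
qed

text \<open>The finitely many exceptional states are paid for by the additive constant. The rate in
  the definition may be negative, hence \<open>max l 0\<close> in the proof.\<close>

lemma drift_function_bound:
  assumes "drift_function Q V"
  obtains l b where "0 \<le> l" "l < 1" "0 \<le> b" "\<And>x. right_act Q V x \<le> l * V x + b"
proof -
  obtain l where l: "l < 1" and fin: "finite {x. \<not> right_act Q V x \<le> l * V x}" and V: "\<And>x. 1 \<le> V x"
    using assms by (auto simp: drift_function_def)
  let ?E = "{x. \<not> right_act Q V x \<le> l * V x}"
  define b where "b = (\<Sum>x\<in>?E. \<bar>right_act Q V x\<bar>)"
  have b: "0 \<le> b" by (simp add: b_def sum_nonneg)
  have "right_act Q V x \<le> max l 0 * V x + b" for x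
  proof (cases "x \<in> ?E")
    case True
    have "\<bar>right_act Q V x\<bar> \<le> b"
      unfolding b_def by (rule member_le_sum[OF True _ fin]) simp
    moreover have "0 \<le> max l 0 * V x" using V[of x] by simp
    ultimately show ?thesis by linarith
  next
    case False
    moreover have "l * V x \<le> max l 0 * V x" using V[of x] by (intro mult_right_mono) auto
    ultimately show ?thesis using b by simp
  qed
  then show thesis using that[of "max l 0" b] l b by simp
qed

text \<open>The diagonal of \<open>Q\<close> being positive, a state that is reached at time \<open>n\<close> can be held
  until any later time, so that finitely many starting points have a common hitting time.\<close>

lemma finite_set_minorization:
  assumes Q: "transition_matrix Q" and ap: "extremely_aperiodic Q"
    and reach: "\<And>x. \<exists>n. 0 < nstep_prob Q n x {a}" and F: "finite F"
  shows "\<exists>n>0. \<exists>\<alpha>>0. \<forall>x\<in>F. \<alpha> \<le> (right_act Q ^^ n) (indicator {a}) x"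
proof -
  let ?T = "right_act Q" and ?e = "indicator {a} :: nat \<Rightarrow> real"
  interpret markov_operator ?T by (rule transition_matrix_markov_operator[OF Q])
  have hold: "Q a a * ?e y \<le> ?T ?e y" for y
  proof (cases "y = a")
    case True
    have "?T ?e a = (\<Sum>z\<in>{a}. Q a z * ?e z)" by (rule right_act_eq_sum) auto
    then show ?thesis using True by simp
  next
    case False
    then show ?thesis by (simp add: nonneg)
  qed
  have step: "0 < (?T ^^ Suc n) ?e x" if "0 < (?T ^^ n) ?e x" for n x
  proof -
    interpret P: markov_operator "?T ^^ n" by (rule power)
    have "0 < Q a a * (?T ^^ n) ?e x"
      using ap that by (simp add: extremely_aperiodic_def)
    also have "\<dots> = (?T ^^ n) (\<lambda>y. Q a a * ?e y) x" by (simp add: P.scale)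
    also have "\<dots> \<le> (?T ^^ n) (?T ?e) x" by (rule P.mono) (rule hold)
    finally show ?thesis by (simp add: funpow_swap1)
  qed
  obtain h where h: "\<And>x. 0 < (?T ^^ h x) ?e x" using reach unfolding nstep_prob_eq by metis
  \<comment> \<open>The sum dominates each hitting time, and \<open>Suc\<close> makes
    \<open>n\<close> positive.\<close>
  define n where "n = Suc (\<Sum>x\<in>F. h x)"
  have pos: "0 < (?T ^^ n) ?e x" if "x \<in> F" for x
  proof -
    have "h x \<le> n" using member_le_sum[OF that, of h] F by (simp add: n_def)
    then show ?thesis by (induction rule: dec_induct) (use h step in blast)+
  qed
  \<comment> \<open>The inserted 1 keeps the minimum meaningful for empty \<open>F\<close>.\<close>
  define \<alpha> where "\<alpha> = Min (insert 1 ((?T ^^ n) ?e ` F))"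
  have "0 < \<alpha>" "\<forall>x\<in>F. \<alpha> \<le> (?T ^^ n) ?e x" using F pos by (auto simp: \<alpha>_def)
  then show ?thesis by (intro exI[of _ n]) (auto simp: n_def)
qed

text \<open>Invariance of \<open>\<pi>\<close> in dual form, by exchanging two finite sums. Since
  the columns of \<open>Q\<close> are finite, the support stays finite and the identity can be
  iterated.\<close>

lemma finite_support_expectation_right_act:
  assumes Q: "transition_matrix Q" and \<pi>: "stationary \<pi> Q" and f: "finite {z. f z \<noteq> 0}"
  shows "finite {z. right_act Q f z \<noteq> 0}"
    and "measure_pmf.expectation \<pi> (right_act Q f) = measure_pmf.expectation \<pi> f"
proof -
  note Q = transition_matrixD[OF Q]
  let ?S = "{z. f z \<noteq> 0}" and ?S' = "\<Union>y\<in>{z. f z \<noteq> 0}. {x. Q x y \<noteq> 0}"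
  have eq: "right_act Q f x = (\<Sum>y\<in>?S. Q x y * f y)" for x
    by (rule right_act_eq_sum) (use f in auto)
  have fin: "finite ?S'" using f Q by blast
  have sub: "x \<in> ?S'" if nz: "right_act Q f x \<noteq> 0" for x
  proof -
    obtain y where "y \<in> ?S" "Q x y * f y \<noteq> 0"
      using nz unfolding eq by (rule sum.not_neutral_contains_not_neutral)
    then show ?thesis by auto
  qed
  show "finite {z. right_act Q f z \<noteq> 0}"
    by (rule finite_subset[OF _ fin]) (use sub in blast)
  have "measure_pmf.expectation \<pi> (right_act Q f) = (\<Sum>x\<in>?S'. right_act Q f x * pmf \<pi> x)"
    by (rule integral_measure_pmf_real[OF fin]) (use sub in blast)
  also have "\<dots> = (\<Sum>y\<in>?S. f y * (\<Sum>x\<in>?S'. Q x y * pmf \<pi> x))"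
    unfolding eq sum_distrib_left sum_distrib_right
    by (subst sum.swap) (simp add: mult_ac)
  also have "\<dots> = (\<Sum>y\<in>?S. f y * pmf \<pi> y)"
  proof (rule sum.cong)
    fix y assume y: "y \<in> ?S"
    have "left_act (pmf \<pi>) Q y = (\<Sum>x\<in>?S'. Q x y * pmf \<pi> x)"
      unfolding left_act_def by (rule suminf_finite[OF fin]) (use y in auto)
    then show "f y * (\<Sum>x\<in>?S'. Q x y * pmf \<pi> x) = f y * pmf \<pi> y"
      using \<pi> by (simp add: stationary_def)
  qed simp
  also have "\<dots> = measure_pmf.expectation \<pi> f"
    by (rule integral_measure_pmf_real[symmetric, OF f]) simp
  finally show "measure_pmf.expectation \<pi> (right_act Q f) = measure_pmf.expectation \<pi> f" .
qed

text \<open>This yields uniqueness: under any stationary measure the mean of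
  \<open>(right_act Q ^^ m) f\<close> does not depend on \<open>m\<close>, while dominated
  convergence with bound 1 sends it to \<open>L\<close>.\<close>

lemma stationary_expectation_limit:
  assumes Q: "transition_matrix Q" and \<pi>: "stationary \<pi> Q"
    and f: "finite {z. f z \<noteq> 0}" "\<And>z. \<bar>f z\<bar> \<le> 1"
    and lim: "\<And>x. (\<lambda>m. (right_act Q ^^ m) f x) \<longlonglongrightarrow> L"
  shows "measure_pmf.expectation \<pi> f = L"
proof -
  interpret markov_operator "right_act Q" by (rule transition_matrix_markov_operator[OF Q])
  have inv: "finite {z. (right_act Q ^^ m) f z \<noteq> 0} \<and>
      measure_pmf.expectation \<pi> ((right_act Q ^^ m) f) = measure_pmf.expectation \<pi> f" for m
  proof (induction m)
    case (Suc m)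
    then show ?case
      using finite_support_expectation_right_act[OF Q \<pi>, of "(right_act Q ^^ m) f"] by simp
  qed (simp add: f)
  have "(\<lambda>m. measure_pmf.expectation \<pi> ((right_act Q ^^ m) f)) \<longlonglongrightarrow> measure_pmf.expectation \<pi> (\<lambda>_. L)"
  proof (rule integral_dominated_convergence[where w = "\<lambda>_. 1"])
    show "AE x in measure_pmf \<pi>. (\<lambda>m. (right_act Q ^^ m) f x) \<longlonglongrightarrow> L"
      by (rule AE_I2) (rule lim)
    show "AE x in measure_pmf \<pi>. norm ((right_act Q ^^ m) f x) \<le> 1" for m
      by (rule AE_I2) (simp add: power_abs_le_one f(2))
  qed simp_all
  then have "(\<lambda>m. measure_pmf.expectation \<pi> f) \<longlonglongrightarrow> L" using inv by simp
  then show ?thesis by (rule LIMSEQ_unique[OF tendsto_const])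
qed

theorem transition_matrix_geometric_ergodicity:
  assumes Q: "transition_matrix Q" and V: "drift_function Q V"
    and ap: "extremely_aperiodic Q"
    and \<psi>: "emeasure (weight_measure \<psi>) UNIV > 0" "psi_irreducible \<psi> Q"
  obtains D \<rho> \<pi> where "0 < D" "0 < \<rho>" "\<rho> < 1"
    "stationary \<pi> Q" "\<And>\<pi>'. stationary \<pi>' Q \<Longrightarrow> \<pi>' = \<pi>"
    "\<And>f m x. finite {z. f z \<noteq> 0} \<Longrightarrow> (\<And>z. \<bar>f z\<bar> \<le> 1) \<Longrightarrow>
      \<bar>(right_act Q ^^ m) f x - measure_pmf.expectation \<pi> f\<bar> \<le> D * \<rho> ^ m * V x"
proof -
  let ?T = "right_act Q"
  interpret markov_operator ?T by (rule transition_matrix_markov_operator[OF Q])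
  have V1: "1 \<le> V x" and Vfin: "finite {x. V x \<le> r}" for x r
    using V by (auto simp: drift_function_def)
  obtain a where "emeasure (weight_measure \<psi>) {a} > 0" using weight_measure_atom[OF \<psi>(1)] .
  then have reach: "\<exists>n. 0 < nstep_prob Q n x {a}" for x
    using \<psi>(2) unfolding psi_irreducible_def by blast
  obtain l b where l: "0 \<le> l" "l < 1" and b: "0 \<le> b" and drift: "\<And>x. ?T V x \<le> l * V x + b"
    using drift_function_bound[OF V] by metis
  have minor: "\<exists>n>0. \<exists>\<alpha>>0. \<forall>x. V x \<le> R \<longrightarrow> \<alpha> \<le> (?T ^^ n) (indicator {a}) x" for R
    using finite_set_minorization[OF Q ap reach Vfin[of R]] by simp
  obtain D \<rho> ell where D: "0 < D" "0 < \<rho>" "\<rho> < 1"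
    and erg: "\<And>f m x. (\<And>z. \<bar>f z\<bar> \<le> 1) \<Longrightarrow> \<bar>(?T ^^ m) f x - ell f\<bar> \<le> D * \<rho> ^ m * V x"
    using geometric_ergodicity[where V = V, OF V1 drift l b minor] by metis
  have lim: "(\<lambda>m. (?T ^^ m) f x) \<longlonglongrightarrow> ell f" if f: "\<And>z. \<bar>f z\<bar> \<le> 1" for f x
  proof (rule LIM_zero_cancel, rule Lim_null_comparison)
    show "\<forall>\<^sub>F m in sequentially. norm ((?T ^^ m) f x - ell f) \<le> D * \<rho> ^ m * V x"
      using erg[where f = f, OF f] by simp
    show "(\<lambda>m. D * \<rho> ^ m * V x) \<longlonglongrightarrow> 0"
      using D by (auto intro!: tendsto_eq_intros LIMSEQ_power_zero)
  qed
  define L where "L j = ell (indicator {j})" for j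
  have limL: "(\<lambda>m. (?T ^^ m) (indicator {j}) x) \<longlonglongrightarrow> L j" for j x
    unfolding L_def by (rule lim) (simp add: indicator_def)
  have TV: "(?T ^^ m) V 0 \<le> V 0 + b / (1 - l)" for m
  proof -
    have "l ^ m * V 0 \<le> 1 * V 0"
      using l V1[of 0] by (intro mult_right_mono) (auto simp: power_le_one)
    then show ?thesis using power_drift[where V = V, OF drift l b, of m 0] by simp
  qed
  obtain \<pi> where \<pi>: "pmf \<pi> = L"
    using limit_pmf[OF markov_operator_axioms V1 Vfin TV limL] .
  \<comment> \<open>The functional \<open>ell\<close> was obtained by choice, so it is identified
    through limits: \<open>f\<close> is a finite combination of point indicators, on which the
    limits are the values of \<open>L\<close>.\<close>
  have ell: "ell f = measure_pmf.expectation \<pi> f" if f: "finite {z. f z \<noteq> 0}" "\<And>z. \<bar>f z\<bar> \<le> 1" for f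
  proof (rule LIMSEQ_unique)
    let ?S = "{z. f z \<noteq> 0}"
    show "(\<lambda>m. (?T ^^ m) f 0) \<longlonglongrightarrow> ell f" by (rule lim[OF f(2)])
    have "(?T ^^ m) f 0 = (\<Sum>j\<in>?S. f j * (?T ^^ m) (indicator {j}) 0)" for m
    proof -
      interpret P: markov_operator "?T ^^ m" by (rule power)
      have "f = (\<lambda>y. \<Sum>j\<in>?S. f j * indicator {j} y)"
        by (rule finite_support_eq_sum[OF f(1)]) simp
      then have "(?T ^^ m) f 0 = (?T ^^ m) (\<lambda>y. \<Sum>j\<in>?S. f j * indicator {j} y) 0" by simp
      then show ?thesis by (simp add: P.sum[OF f(1)] P.scale)
    qed
    moreover have "(\<lambda>m. \<Sum>j\<in>?S. f j * (?T ^^ m) (indicator {j}) 0) \<longlonglongrightarrow> (\<Sum>j\<in>?S. f j * L j)"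
      by (intro tendsto_intros limL)
    moreover have "measure_pmf.expectation \<pi> f = (\<Sum>j\<in>?S. f j * L j)"
      using integral_measure_pmf_real[OF f(1), of \<pi> f] by (simp add: \<pi>)
    ultimately show "(\<lambda>m. (?T ^^ m) f 0) \<longlonglongrightarrow> measure_pmf.expectation \<pi> f" by simp
  qed
  \<comment> \<open>The function \<open>right_act Q (indicator {y})\<close> is column
    \<open>y\<close> of \<open>Q\<close>, a finite combination of point indicators. The sequence at
    times \<open>Suc m\<close> therefore tends both to \<open>left_act L Q y\<close> and to
    \<open>L y\<close>.\<close>
  have "left_act L Q y = L y" for y
  proof (rule LIMSEQ_unique)
    let ?C = "{x. Q x y \<noteq> 0}"
    note Qfin = transition_matrixD(2)[OF Q, of y]
    have "?T (indicator {y}) x = (\<Sum>z\<in>{y}. Q x z * indicator {y} z)" for x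
      by (rule right_act_eq_sum) auto
    then have "?T (indicator {y}) = (\<lambda>x. Q x y)" by (simp add: fun_eq_iff)
    also have "\<dots> = (\<lambda>x. \<Sum>z\<in>?C. Q z y * indicator {z} x)"
      by (rule finite_support_eq_sum[OF Qfin]) simp
    finally have "?T (indicator {y}) = (\<lambda>x. \<Sum>z\<in>?C. Q z y * indicator {z} x)" .
    then have "(?T ^^ Suc m) (indicator {y}) 0 = (\<Sum>z\<in>?C. Q z y * (?T ^^ m) (indicator {z}) 0)" for m
      using markov_operator.sum[OF power Qfin, where f = "\<lambda>z x. Q z y * indicator {z} x"]
      by (simp add: funpow_swap1 markov_operator.scale[OF power])
    moreover have "(\<lambda>m. \<Sum>z\<in>?C. Q z y * (?T ^^ m) (indicator {z}) 0) \<longlonglongrightarrow> (\<Sum>z\<in>?C. Q z y * L z)"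
      by (intro tendsto_intros limL)
    moreover have "left_act L Q y = (\<Sum>z\<in>?C. Q z y * L z)"
      unfolding left_act_def by (rule suminf_finite[OF Qfin]) auto
    ultimately show "(\<lambda>m. (?T ^^ Suc m) (indicator {y}) 0) \<longlonglongrightarrow> left_act L Q y" by simp
    show "(\<lambda>m. (?T ^^ Suc m) (indicator {y}) 0) \<longlonglongrightarrow> L y"
      using limL by (rule LIMSEQ_Suc)
  qed
  then have "stationary \<pi> Q" by (simp add: stationary_def \<pi> fun_eq_iff)
  moreover have "\<pi>' = \<pi>" if "stationary \<pi>' Q" for \<pi>'
  proof (rule pmf_eqI)
    fix j :: nat
    have fin: "finite {z. indicator {j} z \<noteq> (0::real)}" by (simp add: indicator_def)
    have "measure_pmf.expectation \<pi>' (indicator {j}) = L j"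
      by (rule stationary_expectation_limit[OF Q that fin _ limL]) (simp add: indicator_def)
    then have "pmf \<pi>' j = L j" by (simp add: pmf.rep_eq)
    then show "pmf \<pi>' j = pmf \<pi> j" by (simp add: \<pi>)
  qed
  moreover have "\<bar>(?T ^^ m) f x - measure_pmf.expectation \<pi> f\<bar> \<le> D * \<rho> ^ m * V x"
    if "finite {z. f z \<noteq> 0}" "\<And>z. \<bar>f z\<bar> \<le> 1" for f m x
    using erg[where f = f, OF that(2)] ell[OF that] by simp
  ultimately show thesis using that D by blast
qed

section \<open>Approximately Markov processes\<close>

lemma (in prob_space) abs_integral_le_const:
  fixes f :: "'a \<Rightarrow> real"
  assumes "f \<in> borel_measurable M" "\<And>\<omega>. \<omega> \<in> space M \<Longrightarrow> \<bar>f \<omega>\<bar> \<le> B"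
  shows "integrable M f" "\<bar>\<integral>\<omega>. f \<omega> \<partial>M\<bar> \<le> B"
proof -
  show int: "integrable M f"
    by (rule integrable_const_bound[of _ B]) (use assms in auto)
  have "(\<integral>\<omega>. f \<omega> \<partial>M) \<le> B"
    by (rule integral_le_const[OF int], rule AE_I2) (use assms(2) abs_le_D1 in blast)
  moreover have "- B \<le> (\<integral>\<omega>. f \<omega> \<partial>M)"
    by (rule integral_ge_const[OF int], rule AE_I2) (use assms(2) abs_le_D2 minus_le_iff in blast)
  ultimately show "\<bar>\<integral>\<omega>. f \<omega> \<partial>M\<bar> \<le> B" by simp
qed

lemma (in prob_space) integral_discrete_indicator:
  fixes f :: "'b \<Rightarrow> real"
  assumes X: "X \<in> measurable M (count_space A)" and E: "E \<in> events" and S: "finite S"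
    and f: "\<And>\<omega>. \<omega> \<in> space M \<Longrightarrow> X \<omega> \<notin> S \<Longrightarrow> f (X \<omega>) = 0"
  shows "(\<integral>\<omega>. f (X \<omega>) * indicator E \<omega> \<partial>M) = (\<Sum>j\<in>S. f j * prob ({\<omega>\<in>space M. X \<omega> = j} \<inter> E))"
proof -
  have ev: "{\<omega>\<in>space M. X \<omega> = j} \<in> events" for j
  proof -
    have "X -` ({j} \<inter> A) \<inter> space M \<in> events" by (rule measurable_sets[OF X]) simp
    moreover have "X -` ({j} \<inter> A) \<inter> space M = {\<omega>\<in>space M. X \<omega> = j}"
      using measurable_space[OF X] by auto
    ultimately show ?thesis by simp
  qed
  have "(\<integral>\<omega>. f (X \<omega>) * indicator E \<omega> \<partial>M)
      = (\<integral>\<omega>. (\<Sum>j\<in>S. f j * indicator ({\<omega>\<in>space M. X \<omega> = j} \<inter> E) \<omega>) \<partial>M)"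
  proof (rule Bochner_Integration.integral_cong)
    fix \<omega> assume \<omega>: "\<omega> \<in> space M"
    have "(\<Sum>j\<in>S. f j * indicator ({\<omega>\<in>space M. X \<omega> = j} \<inter> E) \<omega>)
        = (\<Sum>j\<in>S. if X \<omega> = j then f j * indicator E \<omega> else 0)"
      by (rule sum.cong) (use \<omega> in \<open>auto simp: indicator_def\<close>)
    also have "\<dots> = f (X \<omega>) * indicator E \<omega>" using S f[OF \<omega>] by auto
    finally show "f (X \<omega>) * indicator E \<omega> = (\<Sum>j\<in>S. f j * indicator ({\<omega>\<in>space M. X \<omega> = j} \<inter> E) \<omega>)" ..
  qed simp
  also have "\<dots> = (\<Sum>j\<in>S. f j * prob ({\<omega>\<in>space M. X \<omega> = j} \<inter> E))"
    using ev E by (subst Bochner_Integration.integral_sum) (auto simp: sets.Int less_top[symmetric])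
  finally show ?thesis .
qed

text \<open>On \<open>Z = 0\<close> the process makes an exact step of \<open>Q\<close>, so
  \<open>f (X (Suc i)) - right_act Q f (X i)\<close> integrates to zero there. On
  \<open>Z = 1\<close> this difference is at most 2 in absolute value.\<close>

lemma transition_step_expectation:
  assumes "prob_space M" and Q: "transition_matrix Q"
    and X: "\<And>i. X i \<in> measurable M (count_space {0..i})"
    and Z: "Z \<in> measurable M (count_space {0, 1 :: nat})"
    and cond: "\<And>s j. s \<in> {0..i} \<Longrightarrow> j \<in> {0..Suc i} \<Longrightarrow>
      \<P>(\<omega> in M. X i \<omega> = s \<and> Z \<omega> = 0) > 0 \<Longrightarrow>
      \<P>(\<omega> in M. X (Suc i) \<omega> = j \<bar> X i \<omega> = s \<and> Z \<omega> = 0) = Q s j"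
    and f: "\<And>z. \<bar>f z\<bar> \<le> 1"
  shows "\<bar>(\<integral>\<omega>. f (X (Suc i) \<omega>) \<partial>M) - (\<integral>\<omega>. right_act Q f (X i \<omega>) \<partial>M)\<bar> \<le> 2 * \<P>(\<omega> in M. Z \<omega> = 1)"
proof -
  interpret prob_space M by fact
  interpret markov_operator "right_act Q" by (rule transition_matrix_markov_operator[OF Q])
  let ?T = "right_act Q"
  note [measurable] = X Z
  note Tf = abs_le_one[where f = f, OF f]
  define B where "B s = prob {\<omega>\<in>space M. X i \<omega> = s \<and> Z \<omega> = 0}" for s
  define A where "A j s = prob {\<omega>\<in>space M. X (Suc i) \<omega> = j \<and> X i \<omega> = s \<and> Z \<omega> = 0}" for j s
  let ?E = "{\<omega>\<in>space M. Z \<omega> = 0}" and ?F = "{\<omega>\<in>space M. Z \<omega> = 1}"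
  have E: "?E \<in> events" "?F \<in> events" by measurable
  have Zval: "Z \<omega> = 0 \<or> Z \<omega> = 1" if "\<omega> \<in> space M" for \<omega>
    using measurable_space[OF Z that] by auto
  have Xval: "X k \<omega> \<le> k" if "\<omega> \<in> space M" for \<omega> k
    using measurable_space[OF X that, of k] by simp
  have evB: "{\<omega>\<in>space M. X i \<omega> = s \<and> Z \<omega> = 0} \<in> events" for s by measurable
  \<comment> \<open>Where the conditioning event is null, the conditional hypothesis says nothing,
    but both sides vanish.\<close>
  have A: "A j s = Q s j * B s" if "s \<le> i" "j \<le> Suc i" for j s
  proof (cases "B s > 0")
    case True
    then show ?thesis using cond[of s j] that by (simp add: cond_prob_def A_def B_def field_simps)
  next
    case False
    then have "B s = 0" by (simp add: B_def order_less_le)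
    moreover have "A j s \<le> B s"
      unfolding A_def B_def by (rule finite_measure_mono[OF _ evB]) auto
    moreover have "0 \<le> A j s" by (simp add: A_def)
    ultimately show ?thesis by simp
  qed
  have AB: "(\<Sum>j\<le>Suc i. A j s) = B s" for s
  proof -
    let ?G = "{\<omega>\<in>space M. X i \<omega> = s \<and> Z \<omega> = 0}"
    have "(\<integral>\<omega>. 1 * indicator ?G \<omega> \<partial>M) = (\<Sum>j\<le>Suc i. 1 * prob ({\<omega>\<in>space M. X (Suc i) \<omega> = j} \<inter> ?G))"
      by (rule integral_discrete_indicator[OF X evB, where f = "\<lambda>_. 1"]) (use Xval in auto)
    moreover have "{\<omega>\<in>space M. X (Suc i) \<omega> = j} \<inter> ?G = {\<omega>\<in>space M. X (Suc i) \<omega> = j \<and> X i \<omega> = s \<and> Z \<omega> = 0}" for j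
      by auto
    ultimately show ?thesis using evB by (simp add: A_def B_def)
  qed
  \<comment> \<open>Since \<open>X (Suc i)\<close> is at most \<open>Suc i\<close>, the row of a state \<open>s\<close> of positive mass is
    supported in \<open>{..Suc i}\<close>.\<close>
  have row: "(\<Sum>j\<le>Suc i. (f j - ?T f s) * A j s) = 0" if s: "s \<le> i" for s
  proof (cases "B s = 0")
    case True
    then show ?thesis using A s by simp
  next
    case False
    note Qs = transition_matrixD[OF Q]
    have "(\<Sum>j\<le>Suc i. Q s j) * B s = 1 * B s"
      using AB[of s] A s by (simp add: sum_distrib_right del: sum.atMost_Suc)
    then have 1: "(\<Sum>j\<le>Suc i. Q s j) = 1" using False mult_right_cancel by blast
    have sm: "summable (Q s)"
      by (rule summable_finite[of "{y. Q s y \<noteq> 0}"]) (use Qs in auto)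
    \<comment> \<open>The entries up to \<open>Suc i\<close> already sum to 1, which leaves no mass
      for any further entry of the row.\<close>
    have "Q s k = 0" if k: "k \<notin> {..Suc i}" for k
    proof -
      have "(\<Sum>j\<in>insert k {..Suc i}. Q s j) \<le> suminf (Q s)"
        by (rule sum_le_suminf[OF sm]) (use Qs in auto)
      then show ?thesis using k 1 Qs(4)[of s] Qs(1)[of s k] by simp
    qed
    then have "?T f s = (\<Sum>j\<le>Suc i. Q s j * f j)"
      by (intro right_act_eq_sum) auto
    moreover have "(\<Sum>j\<le>Suc i. (f j - ?T f s) * A j s)
        = B s * ((\<Sum>j\<le>Suc i. Q s j * f j) - ?T f s * (\<Sum>j\<le>Suc i. Q s j))"
      using A s by (simp add: sum_distrib_left sum_subtractf[symmetric] algebra_simps del: sum.atMost_Suc)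
    ultimately show ?thesis using 1 by simp
  qed
  \<comment> \<open>The pair of consecutive states is treated as one discrete variable with finitely
    many values.\<close>
  let ?h = "\<lambda>p. f (fst p) - ?T f (snd p)" and ?Y = "\<lambda>\<omega>. (X (Suc i) \<omega>, X i \<omega>)"
  have Y: "?Y \<in> measurable M (count_space ({0..Suc i} \<times> {0..i}))"
    by (subst pair_measure_countable[symmetric]) auto
  have h2: "\<bar>?h p\<bar> \<le> 2" for p
    using f[of "fst p"] Tf[of "snd p"] by linarith
  have hm: "(\<lambda>\<omega>. ?h (?Y \<omega>)) \<in> borel_measurable M"
    by (rule measurable_compose[OF Y]) simp
  have "(\<integral>\<omega>. ?h (?Y \<omega>) * indicator ?E \<omega> \<partial>M)
      = (\<Sum>p\<in>{..Suc i} \<times> {..i}. ?h p * prob ({\<omega>\<in>space M. ?Y \<omega> = p} \<inter> ?E))"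
    by (rule integral_discrete_indicator[OF Y E(1)]) (use Xval in auto)
  also have "\<dots> = (\<Sum>p\<in>{..Suc i} \<times> {..i}. ?h p * A (fst p) (snd p))"
    by (rule sum.cong) (auto simp: A_def intro!: arg_cong[where f = prob])
  also have "\<dots> = (\<Sum>s\<le>i. \<Sum>j\<le>Suc i. (f j - ?T f s) * A j s)"
    by (subst sum.swap) (simp add: sum.cartesian_product case_prod_unfold del: sum.atMost_Suc)
  also have "\<dots> = 0" using row by (simp del: sum.atMost_Suc)
  finally have zero: "(\<integral>\<omega>. ?h (?Y \<omega>) * indicator ?E \<omega> \<partial>M) = 0" .
  have intE: "integrable M (\<lambda>\<omega>. ?h (?Y \<omega>) * indicator ?E \<omega>)"
    by (rule abs_integral_le_const(1)[of _ 2])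
       (use hm E h2 in \<open>auto simp: indicator_def intro!: borel_measurable_times borel_measurable_indicator\<close>)
  have intF: "integrable M (\<lambda>\<omega>. ?h (?Y \<omega>) * indicator ?F \<omega>)"
    by (rule abs_integral_le_const(1)[of _ 2])
       (use hm E h2 in \<open>auto simp: indicator_def intro!: borel_measurable_times borel_measurable_indicator\<close>)
  have intf: "integrable M (\<lambda>\<omega>. f (X (Suc i) \<omega>))"
    by (rule abs_integral_le_const(1)[of _ 1]) (use f in \<open>auto intro!: measurable_compose[OF X]\<close>)
  have intT: "integrable M (\<lambda>\<omega>. ?T f (X i \<omega>))"
    by (rule abs_integral_le_const(1)[of _ 1]) (use Tf in \<open>auto intro!: measurable_compose[OF X]\<close>)
  have "(\<integral>\<omega>. f (X (Suc i) \<omega>) \<partial>M) - (\<integral>\<omega>. ?T f (X i \<omega>) \<partial>M) = (\<integral>\<omega>. ?h (?Y \<omega>) \<partial>M)"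
    using intf intT by simp
  also have "\<dots> = (\<integral>\<omega>. ?h (?Y \<omega>) * indicator ?E \<omega> + ?h (?Y \<omega>) * indicator ?F \<omega> \<partial>M)"
    by (rule Bochner_Integration.integral_cong) (use Zval in \<open>force simp: indicator_def\<close>)+
  also have "\<dots> = (\<integral>\<omega>. ?h (?Y \<omega>) * indicator ?F \<omega> \<partial>M)"
    using zero Bochner_Integration.integral_add[OF intE intF] by simp
  finally have eq: "(\<integral>\<omega>. f (X (Suc i) \<omega>) \<partial>M) - (\<integral>\<omega>. ?T f (X i \<omega>) \<partial>M)
      = (\<integral>\<omega>. ?h (?Y \<omega>) * indicator ?F \<omega> \<partial>M)" .
  have "\<bar>\<integral>\<omega>. ?h (?Y \<omega>) * indicator ?F \<omega> \<partial>M\<bar> \<le> (\<integral>\<omega>. \<bar>?h (?Y \<omega>) * indicator ?F \<omega>\<bar> \<partial>M)"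
    by (rule integral_abs_bound)
  also have "\<dots> \<le> (\<integral>\<omega>. 2 * indicator ?F \<omega> \<partial>M)"
  proof (rule integral_mono)
    show "integrable M (\<lambda>\<omega>. \<bar>?h (?Y \<omega>) * indicator ?F \<omega>\<bar>)" using intF by (rule integrable_abs)
    show "integrable M (\<lambda>\<omega>. 2 * indicator ?F \<omega> :: real)" using E by (simp add: less_top[symmetric])
    show "\<bar>?h (?Y \<omega>) * indicator ?F \<omega>\<bar> \<le> 2 * indicator ?F \<omega>" for \<omega>
      using h2[of "?Y \<omega>"] by (auto simp: indicator_def)
  qed
  also have "\<dots> = 2 * prob ?F" using E by simp
  finally show ?thesis unfolding eq .
qed

section \<open>Comparison of the process with the chain and with its limit\<close>

lemma c_transitioningE:
  assumes "c_transitioning c Q M X"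
  obtains Z :: "nat \<Rightarrow> 'a \<Rightarrow> nat" where "\<And>i. X i \<in> measurable M (count_space {0..i})"
    "\<And>i. Z i \<in> measurable M (count_space {0, 1})" "\<And>i. \<P>(\<omega> in M. Z i \<omega> = 1) \<le> c ^ i"
    "\<And>i s j. s \<in> {0..i} \<Longrightarrow> j \<in> {0..Suc i} \<Longrightarrow>
      \<P>(\<omega> in M. X i \<omega> = s \<and> Z i \<omega> = 0) > 0 \<Longrightarrow>
      \<P>(\<omega> in M. X (Suc i) \<omega> = j \<bar> X i \<omega> = s \<and> Z i \<omega> = 0) = Q s j"
proof -
  obtain Z :: "nat \<Rightarrow> 'a \<Rightarrow> nat" where X: "\<forall>i. X i \<in> measurable M (count_space {0..i})"
    and Z: "\<forall>i. Z i \<in> measurable M (count_space {0, 1})" "\<forall>i. \<P>(\<omega> in M. Z i \<omega> = 1) \<le> c ^ i"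
    and cond: "\<forall>i. \<forall>s\<in>{0..i}. \<forall>j\<in>{0..Suc i}. \<P>(\<omega> in M. X i \<omega> = s \<and> Z i \<omega> = 0) > 0 \<longrightarrow>
      \<P>(\<omega> in M. X (Suc i) \<omega> = j \<bar> X i \<omega> = s \<and> Z i \<omega> = 0) = Q s j"
    using assms unfolding c_transitioning_def by (elim conjE exE)
  show thesis
    by (rule that[OF X[rule_format] Z(1)[rule_format] Z(2)[rule_format] cond[rule_format]])
qed

text \<open>Steps are replaced by \<open>Q\<close> one at a time from the last one backwards. Each
  replacement turns \<open>f\<close> into \<open>right_act Q f\<close>, still bounded by 1, so the
  induction varies \<open>f\<close>; the errors \<open>2 * c ^ i\<close> with
  \<open>i \<ge> m\<close> form a geometric tail.\<close>

lemma c_transitioning_expectation: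
  assumes "prob_space M" and Q: "transition_matrix Q" and X: "c_transitioning c Q M X"
    and c: "0 < c" "c < 1" and f: "\<And>z. \<bar>f z\<bar> \<le> 1"
  shows "\<bar>(\<integral>\<omega>. f (X (m + p) \<omega>) \<partial>M) - (\<integral>\<omega>. (right_act Q ^^ p) f (X m \<omega>) \<partial>M)\<bar> \<le> 2 / (1 - c) * c ^ m"
proof -
  interpret markov_operator "right_act Q" by (rule transition_matrix_markov_operator[OF Q])
  obtain Z :: "nat \<Rightarrow> _ \<Rightarrow> nat" where X: "\<And>i. X i \<in> measurable M (count_space {0..i})"
    and Z: "\<And>i. Z i \<in> measurable M (count_space {0, 1})" "\<And>i. \<P>(\<omega> in M. Z i \<omega> = 1) \<le> c ^ i"
    and cond: "\<And>i s j. s \<in> {0..i} \<Longrightarrow> j \<in> {0..Suc i} \<Longrightarrow>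
      \<P>(\<omega> in M. X i \<omega> = s \<and> Z i \<omega> = 0) > 0 \<Longrightarrow>
      \<P>(\<omega> in M. X (Suc i) \<omega> = j \<bar> X i \<omega> = s \<and> Z i \<omega> = 0) = Q s j"
    using X by (rule c_transitioningE) blast
  have step: "\<bar>(\<integral>\<omega>. f (X (Suc i) \<omega>) \<partial>M) - (\<integral>\<omega>. right_act Q f (X i \<omega>) \<partial>M)\<bar> \<le> 2 * c ^ i"
    if "\<And>z. \<bar>f z\<bar> \<le> 1" for f i
    using transition_step_expectation[where f = f and i = i, OF \<open>prob_space M\<close> Q X Z(1) cond that] Z(2)[of i] by simp
  have "\<bar>(\<integral>\<omega>. f (X (m + p) \<omega>) \<partial>M) - (\<integral>\<omega>. (right_act Q ^^ p) f (X m \<omega>) \<partial>M)\<bar>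
      \<le> (\<Sum>i<p. 2 * c ^ (m + i))"
    using f
  proof (induction p arbitrary: f)
    case (Suc p)
    have "\<bar>(\<integral>\<omega>. right_act Q f (X (m + p) \<omega>) \<partial>M)
        - (\<integral>\<omega>. (right_act Q ^^ p) (right_act Q f) (X m \<omega>) \<partial>M)\<bar> \<le> (\<Sum>i<p. 2 * c ^ (m + i))"
      by (rule Suc.IH) (rule abs_le_one[OF Suc.prems])
    then show ?case
      using step[where f = f and i = "m + p", OF Suc.prems] by (simp add: funpow_swap1)
  qed simp
  also have "\<dots> = 2 * c ^ m * (\<Sum>i<p. c ^ i)"
    by (simp add: power_add sum_distrib_left mult.assoc)
  also have "\<dots> \<le> 2 * c ^ m * (1 / (1 - c))"
  proof (rule mult_left_mono)
    have "(\<Sum>i<p. c ^ i) \<le> (\<Sum>i. c ^ i)"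
      by (rule sum_le_suminf) (use c in \<open>auto intro: summable_geometric\<close>)
    then show "(\<Sum>i<p. c ^ i) \<le> 1 / (1 - c)" using c by (simp add: suminf_geometric)
  qed (use c in simp)
  finally show ?thesis by simp
qed

text \<open>The norm is tested by duality against finitely supported functions bounded by 1. The
  first term is the cost of replacing the process by the chain after time \<open>m\<close>, the
  second the distance from \<open>\<pi>\<close> of the chain started at \<open>X m\<close>.\<close>

lemma c_transitioning_l1_bound:
  assumes "prob_space M" and Q: "transition_matrix Q" and X: "c_transitioning c Q M X"
    and c: "0 < c" "c < 1" and d: "1 \<le> d" and D: "0 < D" "0 < \<rho>" and m: "m \<le> r"
    and erg: "\<And>f m x. finite {z. f z \<noteq> 0} \<Longrightarrow> (\<And>z. \<bar>f z\<bar> \<le> 1) \<Longrightarrow>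
      \<bar>(right_act Q ^^ m) f x - measure_pmf.expectation \<pi> f\<bar> \<le> D * \<rho> ^ m * d ^ x"
  shows "l1_norm (\<lambda>j. prob_mass M (X r) j - pmf \<pi> j)
    \<le> 2 / (1 - c) * c ^ m + D * \<rho> ^ (r - m) * d ^ m"
proof -
  interpret prob_space M by fact
  interpret markov_operator "right_act Q" by (rule transition_matrix_markov_operator[OF Q])
  let ?T = "right_act Q" and ?B = "2 / (1 - c) * c ^ m + D * \<rho> ^ (r - m) * d ^ m"
  have Xm: "X i \<in> measurable M (count_space {0..i})" for i
    using X by (simp add: c_transitioning_def)
  define u where "u j = prob_mass M (X r) j - pmf \<pi> j" for j
  have bound: "(\<Sum>j<N. \<bar>u j\<bar>) \<le> ?B" for N
  proof -
    \<comment> \<open>The signs of \<open>u\<close> on an initial segment turn a partial sum of the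
      norm into a difference of two expectations of \<open>f\<close>.\<close>
    define f where "f j = (if j < N then sgn (u j) else 0)" for j
    have f1: "\<bar>f z\<bar> \<le> 1" for z by (simp add: f_def sgn_if)
    have f0: "finite {z. f z \<noteq> 0}" by (rule finite_subset[of _ "{..<N}"]) (auto simp: f_def)
    have "(\<integral>\<omega>. f (X r \<omega>) \<partial>M) = (\<integral>\<omega>. f (X r \<omega>) * indicator (space M) \<omega> \<partial>M)"
      by (rule Bochner_Integration.integral_cong) auto
    also have "\<dots> = (\<Sum>j<N. f j * prob ({\<omega>\<in>space M. X r \<omega> = j} \<inter> space M))"
      by (rule integral_discrete_indicator[OF Xm]) (auto simp: f_def)
    also have "\<dots> = (\<Sum>j<N. f j * prob_mass M (X r) j)"
      unfolding prob_mass_def by (intro sum.cong refl arg_cong2[where f = "(*)"] arg_cong[where f = prob]) auto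
    finally have X_sum: "(\<integral>\<omega>. f (X r \<omega>) \<partial>M) = (\<Sum>j<N. f j * prob_mass M (X r) j)" .
    have \<pi>_sum: "measure_pmf.expectation \<pi> f = (\<Sum>j<N. f j * pmf \<pi> j)"
      by (rule integral_measure_pmf_real) (auto simp: f_def split: if_splits)
    have "(\<Sum>j<N. \<bar>u j\<bar>) = (\<Sum>j<N. f j * u j)"
      by (rule sum.cong) (auto simp: f_def abs_sgn)
    also have "\<dots> = (\<integral>\<omega>. f (X r \<omega>) \<partial>M) - measure_pmf.expectation \<pi> f"
      unfolding X_sum \<pi>_sum by (simp add: u_def sum_subtractf right_diff_distrib)
    also have "\<dots> \<le> \<bar>(\<integral>\<omega>. f (X (m + (r - m)) \<omega>) \<partial>M) - (\<integral>\<omega>. (?T ^^ (r - m)) f (X m \<omega>) \<partial>M)\<bar>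
        + \<bar>(\<integral>\<omega>. (?T ^^ (r - m)) f (X m \<omega>) \<partial>M) - measure_pmf.expectation \<pi> f\<bar>"
      using m by simp
    also have "\<dots> \<le> ?B"
    proof (rule add_mono)
      show "\<bar>(\<integral>\<omega>. f (X (m + (r - m)) \<omega>) \<partial>M) - (\<integral>\<omega>. (?T ^^ (r - m)) f (X m \<omega>) \<partial>M)\<bar>
          \<le> 2 / (1 - c) * c ^ m"
        by (rule c_transitioning_expectation[OF \<open>prob_space M\<close> Q X c f1])
      let ?g = "(?T ^^ (r - m)) f"
      have gm: "(\<lambda>\<omega>. ?g (X m \<omega>)) \<in> borel_measurable M" by (rule measurable_compose[OF Xm]) simp
      have "integrable M (\<lambda>\<omega>. ?g (X m \<omega>))"
        by (rule abs_integral_le_const(1)[OF gm]) (rule power_abs_le_one[OF f1])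
      then have "(\<integral>\<omega>. ?g (X m \<omega>) \<partial>M) - measure_pmf.expectation \<pi> f
          = (\<integral>\<omega>. ?g (X m \<omega>) - measure_pmf.expectation \<pi> f \<partial>M)"
        by (simp add: prob_space)
      moreover have "\<bar>\<integral>\<omega>. ?g (X m \<omega>) - measure_pmf.expectation \<pi> f \<partial>M\<bar> \<le> D * \<rho> ^ (r - m) * d ^ m"
      proof (rule abs_integral_le_const(2))
        show "(\<lambda>\<omega>. ?g (X m \<omega>) - measure_pmf.expectation \<pi> f) \<in> borel_measurable M"
          using gm by simp
        fix \<omega> assume "\<omega> \<in> space M"
        then have "X m \<omega> \<le> m" using measurable_space[OF Xm] by fastforce
        then have "D * \<rho> ^ (r - m) * d ^ X m \<omega> \<le> D * \<rho> ^ (r - m) * d ^ m"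
          using D d by (intro mult_left_mono power_increasing) auto
        then show "\<bar>?g (X m \<omega>) - measure_pmf.expectation \<pi> f\<bar> \<le> D * \<rho> ^ (r - m) * d ^ m"
          using erg[where f = f and m = "r - m" and x = "X m \<omega>", OF f0 f1] by linarith
      qed
      ultimately show "\<bar>(\<integral>\<omega>. ?g (X m \<omega>) \<partial>M) - measure_pmf.expectation \<pi> f\<bar> \<le> D * \<rho> ^ (r - m) * d ^ m"
        by simp
    qed
    finally show ?thesis .
  qed
  have "summable (\<lambda>j. \<bar>u j\<bar>)"
    by (rule summableI_nonneg_bounded[where x = ?B]) (simp, rule bound)
  then have "(\<Sum>j. \<bar>u j\<bar>) \<le> ?B" by (rule suminf_le_const) (rule bound)
  then show ?thesis by (simp add: l1_norm_def u_def)
qed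

lemma split_time_geometric:
  fixes c d D E \<rho> :: real
  assumes c: "0 < c" "c < 1" and d: "1 \<le> d" and DE: "0 < D" "0 < E" and \<rho>: "0 < \<rho>" "\<rho> < 1"
  obtains C \<sigma> where "0 < C" "0 < \<sigma>" "\<sigma> < 1"
    "\<And>r. \<exists>m\<le>r. E * c ^ m + D * \<rho> ^ (r - m) * d ^ m \<le> C * \<sigma> ^ r"
proof -
  \<comment> \<open>\<open>n\<close> steps of decay at rate \<open>\<rho>\<close> outweigh one
    factor \<open>d\<close>: \<open>\<rho> ^ n * d < \<rho>\<close>.\<close>
  obtain n where n: "\<rho> ^ n < \<rho> / d" using real_arch_pow_inv[of "\<rho> / d" \<rho>] \<rho> d by auto
  define \<tau> where "\<tau> = max \<rho> c"
  have \<tau>: "0 < \<tau>" "\<tau> < 1" "\<rho> \<le> \<tau>" "c \<le> \<tau>" using c \<rho> by (auto simp: \<tau>_def)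
  obtain C \<sigma> where C: "0 < C" "0 < \<sigma>" "\<sigma> < 1" "\<And>r. \<tau> ^ (r div Suc n) \<le> C * \<sigma> ^ r"
    using power_div_le_geometric[OF \<tau>(1,2), of "Suc n"] by (metis zero_less_Suc)
  show thesis
  proof (rule that[of "(E + D) * C" \<sigma>])
    fix r
    \<comment> \<open>With this fraction of \<open>r\<close>, the remaining time
      \<open>r - m\<close> is at least \<open>n * m\<close>, so each of the \<open>m\<close> factors
      \<open>d\<close> is offset by \<open>n\<close> steps of decay.\<close>
    define m where "m = r div Suc n"
    have "m * Suc n \<le> r" unfolding m_def by (rule div_times_less_eq_dividend)
    then have m: "n * m \<le> r - m" "m \<le> r" by (auto simp: algebra_simps)
    have "\<rho> ^ (r - m) * d ^ m \<le> \<rho> ^ (n * m) * d ^ m"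
      using m \<rho> d by (intro mult_right_mono power_decreasing) auto
    also have "\<dots> = (\<rho> ^ n * d) ^ m" by (simp add: power_mult power_mult_distrib)
    also have "\<dots> \<le> \<tau> ^ m"
    proof (rule power_mono)
      show "\<rho> ^ n * d \<le> \<tau>" using n d \<tau> by (simp add: field_simps)
    qed (use \<rho> d in auto)
    finally have "D * (\<rho> ^ (r - m) * d ^ m) \<le> D * \<tau> ^ m" using DE by (intro mult_left_mono) auto
    moreover have "E * c ^ m \<le> E * \<tau> ^ m"
      using DE c \<tau> by (intro mult_left_mono power_mono) auto
    ultimately have "E * c ^ m + D * \<rho> ^ (r - m) * d ^ m \<le> (E + D) * \<tau> ^ m"
      by (simp add: algebra_simps)
    also have "\<dots> \<le> (E + D) * (C * \<sigma> ^ r)"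
      using C(4)[of r] DE by (intro mult_left_mono) (auto simp: m_def)
    finally show "\<exists>m\<le>r. E * c ^ m + D * \<rho> ^ (r - m) * d ^ m \<le> (E + D) * C * \<sigma> ^ r"
      using m by (auto simp: mult.assoc)
  qed (use C DE in auto)
qed

text \<open>Every condition on the process depends only on the joint law of all \<open>X i\<close>
  and \<open>Z i\<close>, so it survives pushing \<open>M\<close> forward to the path space. This
  reaches the fixed sample space type for which the constants are chosen.\<close>

lemma c_transitioning_path_space:
  fixes M :: "'a measure"
  assumes "prob_space M" and "c_transitioning c Q M X"
  obtains M' :: "(nat \<Rightarrow> nat \<times> nat) measure" and X' where "prob_space M'" "c_transitioning c Q M' X'"
    "\<And>r j. prob_mass M' (X' r) j = prob_mass M (X r) j"
proof -
  interpret prob_space M by fact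
  obtain Z :: "nat \<Rightarrow> 'a \<Rightarrow> nat" where X: "\<And>i. X i \<in> measurable M (count_space {0..i})"
    and Z: "\<And>i. Z i \<in> measurable M (count_space {0, 1})" "\<And>i. \<P>(\<omega> in M. Z i \<omega> = 1) \<le> c ^ i"
    and cond: "\<And>i s j. s \<in> {0..i} \<Longrightarrow> j \<in> {0..Suc i} \<Longrightarrow>
      \<P>(\<omega> in M. X i \<omega> = s \<and> Z i \<omega> = 0) > 0 \<Longrightarrow>
      \<P>(\<omega> in M. X (Suc i) \<omega> = j \<bar> X i \<omega> = s \<and> Z i \<omega> = 0) = Q s j"
    using assms(2) by (rule c_transitioningE) blast
  define N where "N = PiM (UNIV :: nat set) (\<lambda>i. count_space ({0..i} \<times> {0, 1 :: nat}))"
  define g where "g \<omega> = (\<lambda>i. (X i \<omega>, Z i \<omega>))" for \<omega>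
  define M' where "M' = distr M N g"
  define X' :: "nat \<Rightarrow> (nat \<Rightarrow> nat \<times> nat) \<Rightarrow> nat" where "X' i p = fst (p i)" for i p
  define Z' :: "nat \<Rightarrow> (nat \<Rightarrow> nat \<times> nat) \<Rightarrow> nat" where "Z' i p = snd (p i)" for i p
  have pair: "(\<lambda>\<omega>. (X i \<omega>, Z i \<omega>)) \<in> measurable M (count_space ({0..i} \<times> {0, 1}))" for i
    using measurable_Pair[OF X[of i] Z(1)[of i]] pair_measure_countable[of "{0..i}" "{0, 1 :: nat}"] by simp
  have g: "g \<in> measurable M N"
    unfolding N_def g_def
  proof (rule measurable_PiM_single')
    show "(\<lambda>\<omega> i. (X i \<omega>, Z i \<omega>)) \<in> space M \<rightarrow> (\<Pi>\<^sub>E i\<in>UNIV. space (count_space ({0..i} \<times> {0, 1})))"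
      using measurable_space[OF pair] by (simp add: PiE_iff)
  qed (rule pair)
  have coord: "(\<lambda>p. p i) \<in> measurable N (count_space ({0..i} \<times> {0, 1}))" for i
    unfolding N_def by (rule measurable_component_singleton) simp
  have X'N [measurable]: "X' i \<in> measurable N (count_space {0..i})" for i
    unfolding X'_def by (rule measurable_compose[OF coord]) auto
  have Z'N [measurable]: "Z' i \<in> measurable N (count_space {0, 1})" for i
    unfolding Z'_def by (rule measurable_compose[OF coord]) auto
  \<comment> \<open>Probabilities of measurable path events are those of their preimages under
    \<open>g\<close>; all conditions are transferred through this identity.\<close>
  have push: "\<P>(p in M'. P p) = \<P>(\<omega> in M. P (g \<omega>))" if "{p\<in>space N. P p} \<in> sets N" for P
  proof -
    have "g -` {p\<in>space N. P p} \<inter> space M = {\<omega>\<in>space M. P (g \<omega>)}"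
      using measurable_space[OF g] by blast
    then show ?thesis using measure_distr[OF g that] by (simp add: M'_def)
  qed
  have XZ [simp]: "X' i (g \<omega>) = X i \<omega>" "Z' i (g \<omega>) = Z i \<omega>" for i \<omega>
    by (simp_all add: X'_def Z'_def g_def)
  show thesis
  proof (rule that)
    show "prob_space M'" unfolding M'_def by (rule prob_space_distr[OF g])
    show "prob_mass M' (X' r) j = prob_mass M (X r) j" for r j
    proof -
      have "{p\<in>space N. X' r p = j} \<in> sets N" by measurable
      then show ?thesis unfolding prob_mass_def by (simp add: push)
    qed
    show "c_transitioning c Q M' X'"
      unfolding c_transitioning_def
    proof (intro conjI exI[of _ Z'] allI ballI impI)
      show "X' i \<in> measurable M' (count_space {0..i})" for i
        using X'N by (simp add: M'_def)
      show "Z' i \<in> measurable M' (count_space {0, 1})" for i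
        using Z'N by (simp add: M'_def)
      show "\<P>(p in M'. Z' i p = 1) \<le> c ^ i" for i
      proof -
        have "{p\<in>space N. Z' i p = 1} \<in> sets N" by measurable
        then show ?thesis using Z(2)[of i] by (simp add: push)
      qed
      fix i s j
      assume sj: "s \<in> {0..i}" "j \<in> {0..Suc i}" and pos: "0 < \<P>(p in M'. X' i p = s \<and> Z' i p = 0)"
      have "{p\<in>space N. X' i p = s \<and> Z' i p = 0} \<in> sets N" by measurable
      then have 1: "\<P>(p in M'. X' i p = s \<and> Z' i p = 0) = \<P>(\<omega> in M. X i \<omega> = s \<and> Z i \<omega> = 0)"
        by (simp add: push)
      have "{p\<in>space N. X' (Suc i) p = j \<and> X' i p = s \<and> Z' i p = 0} \<in> sets N" by measurable
      then have 2: "\<P>(p in M'. X' (Suc i) p = j \<and> X' i p = s \<and> Z' i p = 0)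
          = \<P>(\<omega> in M. X (Suc i) \<omega> = j \<and> X i \<omega> = s \<and> Z i \<omega> = 0)"
        by (simp add: push)
      show "\<P>(p in M'. X' (Suc i) p = j \<bar> X' i p = s \<and> Z' i p = 0) = Q s j"
        using cond[OF sj] pos unfolding cond_prob_def 1 2 by simp
    qed
  qed
qed

theorem theorem3p1:
  fixes d c :: real and Q :: "nat \<Rightarrow> nat \<Rightarrow> real" and \<psi> :: "nat \<Rightarrow> real"
  assumes "0 < d" and "0 < c" and "c < 1"
    and "transition_matrix Q"
    and "driftable d Q"
    and "extremely_aperiodic Q"
    and "\<forall>x. 0 \<le> \<psi> x"
    and "emeasure (weight_measure \<psi>) UNIV > 0"
    and "psi_irreducible \<psi> Q"
  shows "\<exists>\<pi> :: nat pmf.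
    stationary \<pi> Q \<and> (\<forall>\<pi>'. stationary \<pi>' Q \<longrightarrow> \<pi>' = \<pi>) \<and>
    0 < conv_C Q c \<and> 0 < conv_rho Q c \<and> conv_rho Q c < 1 \<and>
    (\<forall>(M :: 'a measure) (X :: nat \<Rightarrow> 'a \<Rightarrow> nat).
       prob_space M \<longrightarrow> c_transitioning c Q M X \<longrightarrow>
       (\<forall>r. l1_norm (\<lambda>j. prob_mass M (X r) j - pmf \<pi> j)
              \<le> conv_C Q c * conv_rho Q c ^ r))"
proof -
  have V: "drift_function Q (\<lambda>x. d ^ x)" using assms(5) by (simp add: driftable_def)
  \<comment> \<open>A drift function is at least 1, in particular at the state 1.\<close>
  then have "1 \<le> d ^ 1" unfolding drift_function_def by blast
  then have d: "1 \<le> d" by simp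
  obtain D \<rho> \<pi> where D: "0 < D" "0 < \<rho>" "\<rho> < 1"
    and \<pi>: "stationary \<pi> Q" and unique: "\<And>\<pi>'. stationary \<pi>' Q \<Longrightarrow> \<pi>' = \<pi>"
    and erg: "\<And>f m x. finite {z. f z \<noteq> 0} \<Longrightarrow> (\<And>z. \<bar>f z\<bar> \<le> 1) \<Longrightarrow>
      \<bar>(right_act Q ^^ m) f x - measure_pmf.expectation \<pi> f\<bar> \<le> D * \<rho> ^ m * d ^ x"
    by (rule transition_matrix_geometric_ergodicity[OF assms(4) V assms(6,8,9)]) blast
  have E: "0 < 2 / (1 - c)" using assms by simp
  obtain C \<sigma> where C: "0 < C" "0 < \<sigma>" "\<sigma> < 1"
    and split: "\<And>r. \<exists>m\<le>r. 2 / (1 - c) * c ^ m + D * \<rho> ^ (r - m) * d ^ m \<le> C * \<sigma> ^ r"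
    by (rule split_time_geometric[OF assms(2,3) d D(1) E D(2,3)]) blast
  let ?ok = "\<lambda>(C, \<rho>). 0 < C \<and> 0 < \<rho> \<and> \<rho> < 1 \<and>
        (\<forall>\<pi> (M :: (nat \<Rightarrow> nat \<times> nat) measure) X.
           stationary \<pi> Q \<longrightarrow> prob_space M \<longrightarrow> c_transitioning c Q M X \<longrightarrow>
           (\<forall>r. l1_norm (\<lambda>j. prob_mass M (X r) j - pmf \<pi> j) \<le> C * \<rho> ^ r))"
  \<comment> \<open>This witness shows that the choice in \<open>convergence_constants\<close> is
    not vacuous. The predicate ranges over all stationary measures, which uniqueness reduces to
    \<open>\<pi>\<close>, and does not mention \<open>d\<close>.\<close>
  have "?ok (C, \<sigma>)"
  proof (clarify, intro conjI allI impI C)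
    fix \<pi>' :: "nat pmf" and M :: "(nat \<Rightarrow> nat \<times> nat) measure" and X r
    assume "stationary \<pi>' Q" and M: "prob_space M" "c_transitioning c Q M X"
    then have "\<pi>' = \<pi>" by (intro unique)
    obtain m where m: "m \<le> r" "2 / (1 - c) * c ^ m + D * \<rho> ^ (r - m) * d ^ m \<le> C * \<sigma> ^ r"
      using split[of r] by blast
    have "l1_norm (\<lambda>j. prob_mass M (X r) j - pmf \<pi> j)
        \<le> 2 / (1 - c) * c ^ m + D * \<rho> ^ (r - m) * d ^ m"
      by (rule c_transitioning_l1_bound[OF M(1) assms(4) M(2) assms(2,3) d D(1,2) m(1)]) (rule erg)
    with m(2) show "l1_norm (\<lambda>j. prob_mass M (X r) j - pmf \<pi>' j) \<le> C * \<sigma> ^ r"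
      unfolding \<open>\<pi>' = \<pi>\<close> by simp
  qed
  then have "?ok (convergence_constants Q c)"
    unfolding convergence_constants_def by (rule someI)
  then have ok: "?ok (conv_C Q c, conv_rho Q c)"
    by (simp only: conv_C_def conv_rho_def prod.collapse)
  then have const: "0 < conv_C Q c" "0 < conv_rho Q c" "conv_rho Q c < 1"
    and path: "\<And>(M :: (nat \<Rightarrow> nat \<times> nat) measure) X r. prob_space M \<Longrightarrow> c_transitioning c Q M X \<Longrightarrow>
      l1_norm (\<lambda>j. prob_mass M (X r) j - pmf \<pi> j) \<le> conv_C Q c * conv_rho Q c ^ r"
    using \<pi> by auto
  show ?thesis
  proof (intro exI[of _ \<pi>] conjI allI impI \<pi> unique const)
    fix M :: "'a measure" and X r
    assume "prob_space M" "c_transitioning c Q M X"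
    \<comment> \<open>The bound involves only the law of \<open>X r\<close>, which the realization
      on path space preserves.\<close>
    then obtain M' :: "(nat \<Rightarrow> nat \<times> nat) measure" and X' where "prob_space M'" "c_transitioning c Q M' X'"
      "\<And>r j. prob_mass M' (X' r) j = prob_mass M (X r) j"
      by (rule c_transitioning_path_space) blast
    then show "l1_norm (\<lambda>j. prob_mass M (X r) j - pmf \<pi> j) \<le> conv_C Q c * conv_rho Q c ^ r"
      using path[of M' X' r] by simp
  qed
qed

end
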